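(* Let $S$ be a folding string that is self-avoiding and planefilling, let $\theta$ be its associated folding morphism, and let $z=f(\theta(a))$ be the endpoint of the curve $K[\theta(a)]$ of $S$. Then $S$ is perfect if and only if the curve $K[\theta(a)]$ does not traverse the segment from $(1+i)z-i-1$ to $(1+i)z-i$.
   Context: A folding string is a finite word $S=a_1\ldots a_{m-1}$ ($m\ge 2$) over $\{D,U\}$ with first letter $a_1=D$; such an $S$ codes an $m$-fold. $\overline{S}$ is the word obtained from $S$ by reversing it and exchanging $D$ and $U$. For $S=a_1\ldots a_{s-1}$ and $T=b_1\ldots b_{t-1}$ the folding convolution is $S*T=S\,b_1\,\overline{S}\,b_2\,S\,b_3\,\overline{S}\cdots b_{t-1}X$, in which $t$ blocks alternate between $S$ and $\overline S$ beginning with $S$ (so $X=\overline S$ if $t$ is even, $X=S$ if $t$ is odd). This operation is associative; $S^{*1}=S$, $S^{*(n+1)}=S^{*n}*S$. Since $S^{*n}$ is a prefix of $S^{*(n+1)}$, there is an infinite sequence $S^{*\infty}$ having all $S^{*n}$ as prefixes. Let $A=\{a,b,c,d\}$. $\sigma$ is the morphism of $A^*$ with $\sigma(a)=b,\sigma(b)=c,\sigma(c)=d,\sigma(d)=a$, and $\tau$ is the reversal of words in $A^*$. Let $w:\{D,U\}^*\to\mathbb{Z}$ be the homomorphism with $w(D)=1$, $w(U)=-1$. The folding morphism $\theta=\theta_S:A^*\to A^*$ associated to $S$ is the morphism commuting with $\sigma\tau$ such that $\theta(a)=e_0\ldots e_{m-1}$ with $e_0=a$ and $e_i=\sigma^{w(a_1\ldots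 a_i)}(a)$ for $1\le i\le m-1$; thus $\theta(b)=\sigma\tau\theta(a)$, $\theta(c)=\sigma^2\theta(a)$, $\theta(d)=\sigma^3\tau\theta(a)$. Let $f:A^*\to\mathbb{C}$ be the homomorphism (concatenation to addition) with $f(a)=1,f(b)=i,f(c)=-1,f(d)=-i$. A finite or infinite word $u_0u_1u_2\ldots$ over $A$ determines a lattice path starting at $p_0=0$ with $p_{j+1}=p_j+f(u_j)$, traversing successively the unit segments $[p_j,p_{j+1}]$; $K[u]$ denotes this curve. The curve associated to an infinite sequence $a_1a_2a_3\ldots$ over $\{D,U\}$ is the path of the infinite word $e_0e_1e_2\ldots$ with $e_0=a$, $e_i=\sigma^{w(a_1\ldots a_i)}(a)$; the curve associated to $S^{*\infty}$ is denoted $K[S^{*\infty}]$. Grid points are the Gaussian integers. $S$ is self-avoiding if $K[S^{*\infty}]$ does not traverse any unit segment twice (in either direction). $S$ is planefilling if for arbitrarily large $R>0$ there is a disc of radius $R$ such that $K[S^{*\infty}]$ passes twice through each grid point in this disc. $S$ is perfect if it is self-avoiding and the four rotated curves $K[S^{*\infty}]$, $iK[S^{*\infty}]$, $-K[S^{*\infty}]$, $-iK[S^{*\infty}]$ together cover every edge of the grid (every unit segment joining two neighbouring Gaussian integers, directions being disregarded) exactly once. *)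

theory Defs
  imports "HOL-Analysis.Analysis" "HOL-Library.Sublist"
begin

section \<open>Folding strings\<close>

datatype fold_letter = D | U

definition folding_string :: "fold_letter list \<Rightarrow> bool" where
  "folding_string S \<longleftrightarrow> S \<noteq> [] \<and> hd S = D"

fun exchange :: "fold_letter \<Rightarrow> fold_letter" where
  "exchange D = U"
| "exchange U = D"

definition fold_bar :: "fold_letter list \<Rightarrow> fold_letter list" where
  "fold_bar S = map exchange (rev S)"

lemma fold_bar_fold_bar [simp]: "fold_bar (fold_bar S) = S"
proof -
  have "exchange \<circ> exchange = id"
    by (rule ext, rename_tac x, case_tac x) auto
  then show ?thesis
    by (simp add: fold_bar_def rev_map)
qed

text \<open>
  The blocks alternate because the recursive call is made with the barred string and
  barring is an involution.
\<close>

fun fold_conv :: "fold_letter list \<Rightarrow> fold_letter list \<Rightarrow> fold_letter list" where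
  "fold_conv S [] = S"
| "fold_conv S (b # T) = S @ b # fold_conv (fold_bar S) T"

text \<open>
  The empty string codes the trivial one-fold and is neutral for the convolution, so
  starting the powers at exponent 0 agrees with starting them at \<open>S\<close> with exponent 1.
\<close>

fun fold_power :: "fold_letter list \<Rightarrow> nat \<Rightarrow> fold_letter list" where
  "fold_power S 0 = []"
| "fold_power S (Suc n) = fold_conv (fold_power S n) S"

lemma fold_conv_Nil [simp]: "fold_conv [] T = T"
  by (induction T) (auto simp: fold_bar_def)

lemma fold_power_1: "fold_power S 1 = S"
  by simp

lemma length_fold_conv:
  "Suc (length (fold_conv S T)) = Suc (length S) * Suc (length T)"
  by (induction S T rule: fold_conv.induct) (auto simp: fold_bar_def)

lemma prefix_fold_conv: "prefix S (fold_conv S T)"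
  by (cases T) auto

lemma prefix_fold_power: "n \<le> k \<Longrightarrow> prefix (fold_power S n) (fold_power S k)"
  by (induction k rule: dec_induct) (auto intro: prefix_fold_conv prefix_order.trans)

lemma length_fold_power: "Suc (length (fold_power S n)) = Suc (length S) ^ n"
  by (induction n) (simp_all add: length_fold_conv mult.commute del: mult_Suc mult_Suc_right)

text \<open>
  The entry with index \<open>n\<close> is the letter called \<open>a\<^sub>n\<^sub>+\<^sub>1\<close> when letters are counted from 1; the
  power with exponent \<open>Suc n\<close> is always long enough to determine it.
\<close>

definition fold_limit :: "fold_letter list \<Rightarrow> nat \<Rightarrow> fold_letter" where
  "fold_limit S n = fold_power S (Suc n) ! n"

lemma fold_limit_prefix:
  assumes "folding_string S" and "n < length (fold_power S k)"
  shows "fold_power S k ! n = fold_limit S n"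
proof -
  have "Suc (length S) \<ge> 2"
    using assms(1) by (cases S) (auto simp: folding_string_def)
  then have "2 ^ Suc n \<le> Suc (length (fold_power S (Suc n)))"
    unfolding length_fold_power by (rule power_mono) simp
  moreover have "Suc n < 2 ^ Suc n"
    by (rule less_exp)
  ultimately have n: "n < length (fold_power S (Suc n))"
    by linarith
  show ?thesis
  proof (cases "k \<le> Suc n")
    case True
    then show ?thesis
      using prefix_fold_power[of k "Suc n" S] assms(2)
      by (auto simp: fold_limit_def prefix_def nth_append simp del: fold_power.simps)
  next
    case False
    then show ?thesis
      using prefix_fold_power[of "Suc n" k S] n
      by (auto simp: fold_limit_def prefix_def nth_append simp del: fold_power.simps)
  qed
qed

section \<open>Words of unit steps and the folding morphism\<close>

text \<open>
  The letters \<open>a\<close>, \<open>b\<close>, \<open>c\<close>, \<open>d\<close> stand for unit steps in the directions \<open>1\<close>, \<open>i\<close>, \<open>-1\<close>, \<open>-i\<close>.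
\<close>

datatype step = La | Lb | Lc | Ld

fun rot :: "step \<Rightarrow> step" where
  "rot La = Lb"
| "rot Lb = Lc"
| "rot Lc = Ld"
| "rot Ld = La"

definition sigma :: "step list \<Rightarrow> step list" where
  "sigma u = map rot u"

text \<open>Since \<open>rot\<close> is a bijection of order 4, integer exponents are reduced modulo 4.\<close>

definition rot_pow :: "int \<Rightarrow> step \<Rightarrow> step" where
  "rot_pow k = rot ^^ nat (k mod 4)"

definition fold_weight :: "fold_letter list \<Rightarrow> int" where
  "fold_weight S = (\<Sum>x\<leftarrow>S. case x of D \<Rightarrow> 1 | U \<Rightarrow> -1)"

definition step_word :: "fold_letter list \<Rightarrow> step list" where
  "step_word S = map (\<lambda>i. rot_pow (fold_weight (take i S)) La) [0..<Suc (length S)]"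

definition step_seq :: "(nat \<Rightarrow> fold_letter) \<Rightarrow> nat \<Rightarrow> step" where
  "step_seq s i = rot_pow (fold_weight (map s [0..<i])) La"

fun theta_letter :: "fold_letter list \<Rightarrow> step \<Rightarrow> step list" where
  "theta_letter S La = step_word S"
| "theta_letter S Lb = sigma (rev (step_word S))"
| "theta_letter S Lc = sigma (sigma (step_word S))"
| "theta_letter S Ld = sigma (sigma (sigma (rev (step_word S))))"

definition theta :: "fold_letter list \<Rightarrow> step list \<Rightarrow> step list" where
  "theta S u = concat (map (theta_letter S) u)"

lemma theta_sigma_rev: "theta S (sigma (rev u)) = sigma (rev (theta S u))"
proof -
  have r: "rot (rot (rot (rot x))) = x" for x
    by (cases x) auto
  have s: "theta_letter S (rot x) = sigma (rev (theta_letter S x))" for x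
    by (cases x) (auto simp: sigma_def rev_map comp_def r)
  show ?thesis
    by (induction u) (auto simp: theta_def sigma_def s)
qed

section \<open>Lattice curves\<close>

fun step_value :: "step \<Rightarrow> complex" where
  "step_value La = 1"
| "step_value Lb = \<i>"
| "step_value Lc = -1"
| "step_value Ld = -\<i>"

definition displacement :: "step list \<Rightarrow> complex" where
  "displacement u = (\<Sum>x\<leftarrow>u. step_value x)"

text \<open>
  Segments are point sets, so \<^term>\<open>closed_segment p q = closed_segment q p\<close> and directions
  are disregarded.
\<close>

definition traverses :: "step list \<Rightarrow> complex set \<Rightarrow> bool" where
  "traverses u e \<longleftrightarrow>
     (\<exists>j<length u. closed_segment (displacement (take j u)) (displacement (take (Suc j) u)) = e)"

definition limit_vertex :: "fold_letter list \<Rightarrow> nat \<Rightarrow> complex" where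
  "limit_vertex S j = displacement (map (step_seq (fold_limit S)) [0..<j])"

definition limit_edge :: "fold_letter list \<Rightarrow> nat \<Rightarrow> complex set" where
  "limit_edge S j = closed_segment (limit_vertex S j) (limit_vertex S (Suc j))"

definition grid_points :: "complex set" where
  "grid_points = {p. Re p \<in> \<int> \<and> Im p \<in> \<int>}"

definition grid_edges :: "complex set set" where
  "grid_edges = {closed_segment p q | p q. p \<in> grid_points \<and> q \<in> grid_points \<and> dist p q = 1}"

definition self_avoiding :: "fold_letter list \<Rightarrow> bool" where
  "self_avoiding S \<longleftrightarrow> inj (limit_edge S)"

definition planefilling :: "fold_letter list \<Rightarrow> bool" where
  "planefilling S \<longleftrightarrow>
     (\<forall>r. \<exists>R>r. R > 0 \<and> (\<exists>x. \<forall>p \<in> grid_points \<inter> cball x R. card {j. limit_vertex S j = p} = 2))"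

definition perfect :: "fold_letter list \<Rightarrow> bool" where
  "perfect S \<longleftrightarrow> self_avoiding S \<and>
     (\<forall>e \<in> grid_edges. \<exists>!(k, j). k < (4::nat) \<and> (\<lambda>p. \<i> ^ k * p) ` limit_edge S j = e)"

end

theory Submission
  imports Defs
begin

text \<open>
  Call a grid point even if the sum of its coordinates is even. The curve of \<open>S\<^sup>*\<^sup>\<infinity>\<close> is a fixed
  point of the folding morphism, which acts on undirected edges: with \<open>K\<close> the curve of \<open>S\<close> and
  \<open>z\<close> its endpoint, the edge from the even point \<open>p\<close> to \<open>p + u\<close> is replaced by its tile
  \<open>zp + uK\<close>, a path from \<open>zp\<close> to \<open>z(p + u)\<close>. This rule makes sense for every edge of the
  grid and commutes with the rotations about \<open>0\<close>; the limit curve grows out of the edge from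
  \<open>0\<close> to \<open>1\<close>, the four rotated curves out of the star of the four edges at \<open>0\<close>.

  Arbitrarily large discs are filled by the limit curve, and every finite configuration of
  edges can be translated into such a disc. Hence the tiles of all edges together cover every
  edge exactly once (\<open>tile_inj\<close>, \<open>tile_surj\<close>), and every edge has a unique parent, the edge
  whose tile contains it. The four curves never share an edge, and \<open>S\<close> is perfect precisely
  when the iterated parents of every edge end in the star.

  One direction is then immediate. The edge \<open>h\<close> from \<open>1 + i\<close> to \<open>i\<close> has the tile
  \<open>(1 + i)z - K\<close>, so the condition of the theorem says that \<open>h\<close> is not its own parent, and
  an edge outside the star that is its own parent is never reached from the star.

  For the other direction the parent map is extended to faces. Colour the unit squares like a
  chessboard. The tiles of the four sides of a square form a closed loop that turns at every
  vertex, and therefore has one fixed colour on its inner side all along. Two different loops of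
  the same colour cannot both have a common face on their inner sides: each would lie inside the
  other, which fails at a rightmost enclosed face (\<open>no_common_enclosed_face\<close>). The fixed star
  shows that the inner side has the colour of the original square, and it follows that the
  parents of the four sides of a face are sides of one face (\<open>parent_respects_faces\<close>). So the
  parent map is a map of faces that preserves adjacency, and it does not increase the
  \<open>\<ell>\<^sup>1\<close>-distance of faces (\<open>ancestor_contracts\<close>). It fixes the four faces around \<open>0\<close>, so every
  orbit is bounded and eventually periodic. A periodic face in the first quadrant other than the
  square at \<open>0\<close> is incompatible with this contraction: of the two further edges of that square,
  the one from \<open>1\<close> to \<open>1 + i\<close> moves to the star, away from faces to the right, and
  \<open>h\<close>, unless it is its own parent, moves to the star as well, away from faces above
  (\<open>fixed_face_quadrant\<close>). Hence all orbits end in the star.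
\<close>

section \<open>Gaussian integers\<close>

text \<open>
  Parities and orders of coordinates matter below, so grid points are pairs of integers with their
  ring structure; \<open>cpx\<close> embeds them into the complex numbers.
\<close>

datatype gauss = Gauss (re: int) (im: int)

lemma gauss_eq_iff: "x = y \<longleftrightarrow> re x = re y \<and> im x = im y"
  by (cases x; cases y) auto

instantiation gauss :: comm_ring_1
begin

definition "0 = Gauss 0 0"
definition "1 = Gauss 1 0"
definition "x + y = Gauss (re x + re y) (im x + im y)"
definition "x - y = Gauss (re x - re y) (im x - im y)"
definition "- x = Gauss (- re x) (- im x)"
definition "x * y = Gauss (re x * re y - im x * im y) (re x * im y + im x * re y)"

instance
  by standard
    (auto simp: gauss_eq_iff zero_gauss_def one_gauss_def plus_gauss_def minus_gauss_def
      uminus_gauss_def times_gauss_def algebra_simps)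

end

lemma gauss_sel [simp]:
  "re 0 = 0" "im 0 = 0" "re 1 = 1" "im 1 = 0"
  "re (x + y) = re x + re y" "im (x + y) = im x + im y"
  "re (x - y) = re x - re y" "im (x - y) = im x - im y"
  "re (- x) = - re x" "im (- x) = - im x"
  "re (x * y) = re x * re y - im x * im y" "im (x * y) = re x * im y + im x * re y"
  by (simp_all add: zero_gauss_def one_gauss_def plus_gauss_def minus_gauss_def
      uminus_gauss_def times_gauss_def)

lemma gauss_sel_numeral [simp]: "re (numeral n) = numeral n" "im (numeral n) = 0"
proof -
  have "re (of_nat k) = int k \<and> im (of_nat k) = 0" for k
    by (induction k) auto
  from this[of "numeral n"] show "re (numeral n) = numeral n" "im (numeral n) = 0"
    by auto
qed

definition gi :: gauss where "gi = Gauss 0 1"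

lemma gi_sel [simp]: "re gi = 0" "im gi = 1"
  by (simp_all add: gi_def)

lemma gi_gi [simp]: "gi * gi = -1" "gi * (gi * x) = - x"
  by (simp_all add: gauss_eq_iff)

definition cpx :: "gauss \<Rightarrow> complex" where
  "cpx x = Complex (of_int (re x)) (of_int (im x))"

lemma cpx_simps [simp]:
  "cpx 0 = 0" "cpx 1 = 1" "cpx gi = \<i>" "cpx (x + y) = cpx x + cpx y"
  "cpx (x - y) = cpx x - cpx y" "cpx (- x) = - cpx x" "cpx (x * y) = cpx x * cpx y"
  by (simp_all add: cpx_def complex_eq_iff)

lemma cpx_power [simp]: "cpx (x ^ n) = cpx x ^ n"
  by (induction n) auto

lemma cpx_eq_iff [simp]: "cpx x = cpx y \<longleftrightarrow> x = y"
  by (simp add: cpx_def gauss_eq_iff)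

lemma range_cpx: "range cpx = grid_points"
proof
  show "range cpx \<subseteq> grid_points"
    by (auto simp: grid_points_def cpx_def)
  show "grid_points \<subseteq> range cpx"
  proof
    fix p assume "p \<in> grid_points"
    then obtain a b where "Re p = of_int a" "Im p = of_int b"
      by (auto simp: grid_points_def elim!: Ints_cases)
    then have "p = cpx (Gauss a b)"
      by (simp add: cpx_def complex_eq_iff)
    then show "p \<in> range cpx" by blast
  qed
qed

definition dirs :: "gauss set" where
  "dirs = {1, gi, -1, -gi}"

lemma dirs_cases:
  assumes "u \<in> dirs"
  obtains "u = 1" | "u = gi" | "u = -1" | "u = -gi"
  using assms by (auto simp: dirs_def)

lemma dirs_mult: "u \<in> dirs \<Longrightarrow> v \<in> dirs \<Longrightarrow> u * v \<in> dirs"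
  by (auto simp: dirs_def)

lemma dirs_simps [simp]: "1 \<in> dirs" "gi \<in> dirs" "-1 \<in> dirs" "-gi \<in> dirs"
  by (auto simp: dirs_def)

lemma dirs_uminus: "u \<in> dirs \<Longrightarrow> - u \<in> dirs"
  by (auto simp: dirs_def)

lemma norm_cpx_dir: "u \<in> dirs \<Longrightarrow> norm (cpx u) = 1"
  by (auto simp: dirs_def)

lemma gi_power_in_dirs: "gi ^ k \<in> dirs"
  by (induction k) (auto simp: dirs_mult)

lemma dirs_eq_gi_power:
  assumes "u \<in> dirs"
  shows "\<exists>k<4. u = gi ^ k"
  using assms
proof (cases rule: dirs_cases)
  case 1
  then show ?thesis by (intro exI[of _ 0]) simp
next
  case 2
  then show ?thesis by (intro exI[of _ 1]) simp
next
  case 3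
  then show ?thesis by (intro exI[of _ 2]) (simp add: power2_eq_square)
next
  case 4
  then show ?thesis by (intro exI[of _ 3]) (simp add: power3_eq_cube)
qed

lemma gi_power_inj:
  assumes "gi ^ k = gi ^ l" "k < 4" "l < 4"
  shows "k = l"
proof -
  have "gi ^ 0 = 1" "gi ^ 1 = gi" "gi ^ 2 = -1" "gi ^ 3 = -gi"
    by (simp_all add: power2_eq_square power3_eq_cube)
  moreover have "k \<in> {0,1,2,3}" "l \<in> {0,1,2,3}"
    using assms(2,3) by auto
  ultimately show ?thesis using assms(1)
    by (auto simp: gauss_eq_iff)
qed

section \<open>Undirected grid edges as darts\<close>

text \<open>
  An undirected edge has exactly one even endpoint \<open>p\<close> and is represented by \<open>(p, u)\<close>, where
  \<open>p + u\<close> is its other endpoint. This makes tiles an algebraic expression in \<open>p\<close> and \<open>u\<close>.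
\<close>

type_synonym dart = "gauss \<times> gauss"

definition even_pt :: "gauss \<Rightarrow> bool" where
  "even_pt p \<longleftrightarrow> even (re p + im p)"

lemma even_pt_simps [simp]:
  "even_pt 0"
  "even_pt (p - q) \<longleftrightarrow> (even_pt p \<longleftrightarrow> even_pt q)"
  "even_pt (p + q) \<longleftrightarrow> (even_pt p \<longleftrightarrow> even_pt q)"
  "even_pt (- p) \<longleftrightarrow> even_pt p"
  by (auto simp: even_pt_def)

lemma even_pt_mult: "even_pt p \<Longrightarrow> even_pt (q * p)" "even_pt p \<Longrightarrow> even_pt (p * q)"
  unfolding even_pt_def by (simp_all, presburger+)

lemma odd_dir: "u \<in> dirs \<Longrightarrow> \<not> even_pt u"
  by (auto simp: dirs_def even_pt_def)

definition darts :: "dart set" where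
  "darts = {(p, u). even_pt p \<and> u \<in> dirs}"

definition segment :: "dart \<Rightarrow> complex set" where
  "segment e = closed_segment (cpx (fst e)) (cpx (fst e + snd e))"

lemma segment_inj:
  assumes "e \<in> darts" "f \<in> darts" "segment e = segment f"
  shows "e = f"
proof -
  obtain p u q v where ef: "e = (p, u)" "f = (q, v)"
    by (cases e; cases f)
  have "p = q \<and> p + u = q + v \<or> p = q + v \<and> p + u = q"
    using assms(3) by (auto simp: ef segment_def closed_segment_eq doubleton_eq_iff
        simp flip: cpx_simps)
  moreover have "p \<noteq> q + v"
    using assms(1,2) odd_dir[of v] by (auto simp: ef darts_def)
  ultimately show ?thesis by (auto simp: ef)
qed

lemma unit_gauss:
  assumes "norm (cpx u) = 1"
  shows "u \<in> dirs"
proof -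
  have "(of_int (re u))\<^sup>2 + (of_int (im u))\<^sup>2 = (1::real)"
    using assms by (simp add: cpx_def cmod_def)
  then have *: "(re u)\<^sup>2 + (im u)\<^sup>2 = 1"
    by (metis of_int_1 of_int_add of_int_eq_iff of_int_power)
  have "(re u)\<^sup>2 \<le> 1"
    using * zero_le_power2[of "im u"] by linarith
  moreover have "(im u)\<^sup>2 \<le> 1"
    using * zero_le_power2[of "re u"] by linarith
  ultimately have "\<bar>re u\<bar> \<le> 1" "\<bar>im u\<bar> \<le> 1"
    by (simp_all add: abs_square_le_1)
  then have "re u \<in> {-1, 0, 1}" "im u \<in> {-1, 0, 1}" by auto
  then show ?thesis using * by (auto simp: dirs_def gauss_eq_iff)
qed

lemma segment_image: "segment ` darts = grid_edges"
proof
  show "segment ` darts \<subseteq> grid_edges"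
  proof clarify
    fix p u assume "(p, u) \<in> darts"
    then have "dist (cpx p) (cpx (p + u)) = 1"
      by (simp add: darts_def norm_cpx_dir dist_norm)
    moreover have "cpx p \<in> grid_points" "cpx (p + u) \<in> grid_points"
      using range_cpx by blast+
    ultimately show "segment (p, u) \<in> grid_edges"
      unfolding grid_edges_def segment_def by auto
  qed
  show "grid_edges \<subseteq> segment ` darts"
  proof
    fix s assume "s \<in> grid_edges"
    then obtain p q where s: "s = closed_segment (cpx p) (cpx q)" "dist (cpx p) (cpx q) = 1"
      unfolding grid_edges_def range_cpx[symmetric] by auto
    have pq: "q - p \<in> dirs" "p - q \<in> dirs"
      using s(2) by (auto intro!: unit_gauss simp: dist_norm norm_minus_commute)
    show "s \<in> segment ` darts"
    proof (cases "even_pt p")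
      case True
      then have "(p, q - p) \<in> darts" using pq by (simp add: darts_def)
      moreover have "s = segment (p, q - p)" by (simp add: s segment_def)
      ultimately show ?thesis by blast
    next
      case False
      then have "(q, p - q) \<in> darts" using pq odd_dir[OF pq(1)] by (simp add: darts_def)
      moreover have "s = segment (q, p - q)"
        by (simp add: s segment_def closed_segment_commute)
      ultimately show ?thesis by blast
    qed
  qed
qed

definition shift :: "gauss \<Rightarrow> dart \<Rightarrow> dart" where
  "shift a e = (a + fst e, snd e)"

definition turn_by :: "gauss \<Rightarrow> dart \<Rightarrow> dart" where
  "turn_by v e = (v * fst e, v * snd e)"

lemma shift_darts: "even_pt a \<Longrightarrow> e \<in> darts \<Longrightarrow> shift a e \<in> darts"
  by (auto simp: shift_def darts_def)

lemma turn_by_darts: "v \<in> dirs \<Longrightarrow> e \<in> darts \<Longrightarrow> turn_by v e \<in> darts"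
  by (auto simp: turn_by_def darts_def even_pt_mult dirs_mult)

lemma segment_turn_by: "segment (turn_by v e) = (\<lambda>x. cpx v * x) ` segment e"
proof -
  have "closed_segment (cpx v * a) (cpx v * b) = (\<lambda>x. cpx v * x) ` closed_segment a b" for a b
    by (rule closed_segment_linear_image) (rule linear_times)
  then show ?thesis
    by (simp add: segment_def turn_by_def flip: distrib_left)
qed

section \<open>Faces\<close>

text \<open>
  A face is represented by twice its centre, a point with two odd coordinates. Orient horizontal
  edges from their even to their odd endpoint and vertical edges from their odd to their even
  endpoint: then each unit square is surrounded cyclically, with alternating sense as on a
  chessboard, and the limit curve follows the orientation. With respect to it, \<open>lface\<close> is the
  face on the left and \<open>rface\<close> the face on the right of an edge.
\<close>

definition lface :: "dart \<Rightarrow> gauss" where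
  "lface e = (let s = re (snd e) + im (snd e) in 2 * fst e + Gauss s s)"

definition rface :: "dart \<Rightarrow> gauss" where
  "rface e = (let s = re (snd e) - im (snd e) in 2 * fst e + Gauss s (- s))"

text \<open>
  The colour of a face is \<open>True\<close> if the edges run around it counterclockwise. Each edge has one
  face of either colour.
\<close>

definition side :: "bool \<Rightarrow> dart \<Rightarrow> gauss" where
  "side c e = (if c then lface e else rface e)"

lemma side_simps [simp]: "side True e = lface e" "side False e = rface e"
  by (simp_all add: side_def)

lemma faces_sel:
  "re (lface e) = 2 * re (fst e) + re (snd e) + im (snd e)"
  "im (lface e) = 2 * im (fst e) + re (snd e) + im (snd e)"
  "re (rface e) = 2 * re (fst e) + re (snd e) - im (snd e)"
  "im (rface e) = 2 * im (fst e) - re (snd e) + im (snd e)"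
  by (simp_all add: lface_def rface_def Let_def)

lemma face_colour:
  assumes "e \<in> darts"
  shows "4 dvd re (side c e) + im (side c e) \<longleftrightarrow> \<not> c"
proof -
  have "even (re (fst e) + im (fst e))" "snd e \<in> dirs"
    using assms by (auto simp: darts_def even_pt_def)
  then show ?thesis
    by (cases c; elim dirs_cases) (simp_all add: faces_sel; presburger)+
qed

lemma side_colour: "e \<in> darts \<Longrightarrow> f \<in> darts \<Longrightarrow> side c e = side c' f \<Longrightarrow> c = c'"
  by (metis face_colour)

text \<open>
  Successive edges of a path that turns by a right angle form a corner of a unit square, and they
  have this square on the same side.
\<close>

definition adj :: "dart \<Rightarrow> dart \<Rightarrow> bool" where
  "adj e f \<longleftrightarrow> lface e = lface f \<or> rface e = rface f"

lemma face_shift: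
  "lface (shift a e) = 2 * a + lface e" "rface (shift a e) = 2 * a + rface e"
  by (simp_all add: gauss_eq_iff faces_sel shift_def)

lemma face_turn_by_gi:
  "lface (turn_by gi e) = gi * rface e" "rface (turn_by gi e) = gi * lface e"
  by (simp_all add: gauss_eq_iff faces_sel turn_by_def)

lemma turn_by_power: "turn_by (gi ^ Suc k) e = turn_by gi (turn_by (gi ^ k) e)"
  by (simp add: turn_by_def mult.assoc)

lemma adj_shift: "adj e f \<Longrightarrow> adj (shift a e) (shift a f)"
  by (auto simp: adj_def face_shift)

text \<open>
  A quarter turn exchanges the two colours, so the two disjuncts of \<^const>\<open>adj\<close> may be swapped.
\<close>

lemma adj_turn_by:
  assumes "adj e f" "v \<in> dirs"
  shows "adj (turn_by v e) (turn_by v f)"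
proof -
  have "adj (turn_by (gi ^ k) e) (turn_by (gi ^ k) f)" for k
  proof (induction k)
    case 0
    then show ?case using assms(1) by (simp add: turn_by_def)
  next
    case (Suc k)
    then show ?case by (auto simp: turn_by_power adj_def face_turn_by_gi simp del: power_Suc)
  qed
  then show ?thesis using dirs_eq_gi_power[OF assms(2)] by blast
qed

lemma adj_corner:
  assumes "u \<in> dirs" "v = gi * u \<or> v = - gi * u"
  shows "adj (p, u) (p, v)" and "adj (p - u, u) (p - v, v)"
  using assms(1) assms(2)
  by (elim dirs_cases; auto simp: adj_def gauss_eq_iff faces_sel)+


section \<open>Self-similarity of the limit curve\<close>

lemma length_fold_bar [simp]: "length (fold_bar A) = length A"
  by (simp add: fold_bar_def)

lemma fold_bar_append: "fold_bar (A @ B) = fold_bar B @ fold_bar A"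
  by (simp add: fold_bar_def)

lemma fold_bar_Cons: "fold_bar (x # A) = fold_bar A @ [exchange x]"
  by (simp add: fold_bar_def)

lemma fold_bar_Nil [simp]: "fold_bar [] = []"
  by (simp add: fold_bar_def)

lemma fold_conv_append:
  "fold_conv A (X @ c # Y) =
     fold_conv A X @ c # fold_conv (if even (length X) then fold_bar A else A) Y"
  by (induction X arbitrary: A) auto

lemma fold_bar_conv:
  "fold_bar (fold_conv A B) =
     fold_conv (if even (length B) then fold_bar A else A) (fold_bar B)"
proof (induction B arbitrary: A)
  case (Cons b B)
  then show ?case
    by (auto simp: fold_bar_append fold_bar_Cons fold_conv_append)
qed simp

lemma fold_conv_assoc: "fold_conv (fold_conv A B) C = fold_conv A (fold_conv B C)"
  by (induction C arbitrary: A B) (auto simp: fold_conv_append fold_bar_conv)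

text \<open>
  The powers multiply by \<open>S\<close> on the right. Multiplying on the left instead exhibits the limit
  sequence as a sequence of blocks \<open>S\<close> and \<open>fold_bar S\<close> that are separated by the limit
  sequence itself.
\<close>

lemma fold_power_Suc_left: "fold_power S (Suc n) = fold_conv S (fold_power S n)"
proof (induction n)
  case (Suc n)
  have "fold_power S (Suc (Suc n)) = fold_conv (fold_power S (Suc n)) S"
    by (rule fold_power.simps)
  also have "\<dots> = fold_conv S (fold_power S (Suc n))"
    by (simp only: Suc.IH fold_conv_assoc fold_power.simps(2)[symmetric])
  finally show ?case .
qed simp

lemma nth_fold_conv_block:
  assumes "j < length A" "k \<le> length T"
  shows "fold_conv A T ! (Suc (length A) * k + j) = (if even k then A else fold_bar A) ! j"
  using assms
proof (induction T arbitrary: A k)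
  case (Cons b T)
  show ?case
  proof (cases k)
    case 0
    then show ?thesis using Cons.prems by (simp add: nth_append)
  next
    case (Suc l)
    have "Suc (length A) * k + j = length A + Suc (Suc (length A) * l + j)"
      by (simp add: Suc)
    then have "fold_conv A (b # T) ! (Suc (length A) * k + j) =
        fold_conv (fold_bar A) T ! (Suc (length A) * l + j)"
      by (simp only: fold_conv.simps nth_append_length_plus nth_Cons_Suc)
    then show ?thesis
      using Cons.IH[of "fold_bar A" l] Cons.prems Suc by auto
  qed
qed simp

lemma nth_fold_conv_separator:
  assumes "k < length T"
  shows "fold_conv A T ! (Suc (length A) * k + length A) = T ! k"
  using assms
proof (induction T arbitrary: A k)
  case (Cons b T)
  show ?case
  proof (cases k)
    case (Suc l)
    have "Suc (length A) * k + length A = length A + Suc (Suc (length A) * l + length A)"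
      by (simp add: Suc)
    then have "fold_conv A (b # T) ! (Suc (length A) * k + length A) =
        fold_conv (fold_bar A) T ! (Suc (length A) * l + length A)"
      by (simp only: fold_conv.simps nth_append_length_plus nth_Cons_Suc)
    then show ?thesis
      using Cons.IH[of l "fold_bar A"] Cons.prems Suc by simp
  qed simp
qed simp

fun turn :: "fold_letter \<Rightarrow> gauss" where
  "turn D = gi"
| "turn U = - gi"

lemma turn_exchange: "turn (exchange x) * turn x = 1"
  by (cases x) (simp_all add: gauss_eq_iff)

primrec heading :: "(nat \<Rightarrow> fold_letter) \<Rightarrow> nat \<Rightarrow> gauss" where
  "heading s 0 = 1"
| "heading s (Suc n) = turn (s n) * heading s n"

definition vertex :: "(nat \<Rightarrow> fold_letter) \<Rightarrow> nat \<Rightarrow> gauss" where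
  "vertex s n = (\<Sum>l<n. heading s l)"

lemma vertex_0 [simp]: "vertex s 0 = 0"
  and vertex_Suc: "vertex s (Suc n) = vertex s n + heading s n"
  by (simp_all add: vertex_def)

lemma heading_dirs [simp]: "heading s n \<in> dirs"
proof (induction n)
  case (Suc n)
  then show ?case by (cases "s n") (auto simp: dirs_def)
qed simp

lemma even_pt_vertex: "even_pt (vertex s n) \<longleftrightarrow> even n"
  by (induction n) (auto simp: vertex_Suc odd_dir)

lemma rot_pow_add_1: "rot_pow (k + 1) x = rot (rot_pow k x)"
proof -
  have r: "rot (rot (rot (rot y))) = y" for y by (cases y) auto
  have "k mod 4 = 0 \<or> k mod 4 = 1 \<or> k mod 4 = 2 \<or> k mod 4 = 3" by presburger
  then show ?thesis
    unfolding rot_pow_def mod_add_left_eq[of k 4 1, symmetric]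
    by (elim disjE) (simp_all add: numeral_2_eq_2 numeral_3_eq_3 r)
qed

lemma step_value_rot: "step_value (rot x) = \<i> * step_value x"
  by (cases x) auto

lemma step_value_rot_pow:
  "step_value (rot_pow (k + 1) x) = \<i> * step_value (rot_pow k x)"
  "step_value (rot_pow (k - 1) x) = - \<i> * step_value (rot_pow k x)"
  using rot_pow_add_1[of k x] rot_pow_add_1[of "k - 1" x] by (simp_all add: step_value_rot)

lemma step_value_step_seq: "step_value (step_seq s n) = cpx (heading s n)"
proof (induction n)
  case (Suc n)
  have "fold_weight (map s [0..<Suc n]) =
      fold_weight (map s [0..<n]) + (case s n of D \<Rightarrow> 1 | U \<Rightarrow> -1)"
    by (simp add: fold_weight_def)
  then have "step_seq s (Suc n) =
      rot_pow (fold_weight (map s [0..<n]) + (case s n of D \<Rightarrow> 1 | U \<Rightarrow> -1)) La"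
    by (simp only: step_seq_def)
  then show ?case
    using Suc step_value_rot_pow[of "fold_weight (map s [0..<n])" La]
    by (cases "s n") (simp_all add: step_seq_def)
qed (simp add: step_seq_def fold_weight_def rot_pow_def)

lemma displacement_step_seq: "displacement (map (step_seq s) [0..<n]) = cpx (vertex s n)"
  by (induction n) (simp_all add: displacement_def vertex_Suc step_value_step_seq)

text \<open>
  The limit curve starts at the even point \<open>0\<close>, so its vertex with index \<open>n\<close> is even iff \<open>n\<close>
  is: the curve runs through its edges alternately away from and towards the even endpoint.
\<close>

definition curve_dart :: "(nat \<Rightarrow> fold_letter) \<Rightarrow> nat \<Rightarrow> dart" where
  "curve_dart s n =
     (if even n then (vertex s n, heading s n) else (vertex s (Suc n), - heading s n))"

lemma curve_dart_darts [simp]: "curve_dart s n \<in> darts"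
  by (auto simp: curve_dart_def darts_def even_pt_vertex dirs_uminus simp del: heading.simps)

lemma curve_dart_ends:
  "{fst (curve_dart s n), fst (curve_dart s n) + snd (curve_dart s n)} =
     {vertex s n, vertex s (Suc n)}"
  by (auto simp: curve_dart_def vertex_Suc)

lemma segment_curve_dart:
  "segment (curve_dart s n) = closed_segment (cpx (vertex s n)) (cpx (vertex s (Suc n)))"
  by (auto simp: segment_def curve_dart_def vertex_Suc closed_segment_commute)

lemma limit_edge_eq: "limit_edge S n = segment (curve_dart (fold_limit S) n)"
  by (simp add: limit_edge_def limit_vertex_def displacement_step_seq segment_curve_dart
      del: upt_Suc)

lemma adj_curve_dart: "adj (curve_dart s n) (curve_dart s (Suc n))"
proof -
  let ?u = "heading s n" and ?v = "heading s (Suc n)"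
  have uv: "?v = gi * ?u \<or> ?v = - gi * ?u"
    by (cases "s n") auto
  show ?thesis
  proof (cases "even n")
    case True
    have *: "- ?v = gi * ?u \<or> - ?v = - gi * ?u"
      using uv by auto
    have "curve_dart s n = (vertex s (Suc n) - ?u, ?u)"
      "curve_dart s (Suc n) = (vertex s (Suc n) - - ?v, - ?v)"
      using True by (simp_all add: curve_dart_def vertex_Suc)
    then show ?thesis
      using adj_corner(2)[OF heading_dirs *, of "vertex s (Suc n)"] by metis
  next
    case False
    have *: "?v = gi * - ?u \<or> ?v = - gi * - ?u"
      using uv by auto
    show ?thesis
      using adj_corner(1)[OF _ *, of "vertex s (Suc n)"] False
      by (simp add: curve_dart_def dirs_uminus)
  qed
qed

locale folding =
  fixes S :: "fold_letter list"
  assumes folding: "folding_string S"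
begin

abbreviation letters :: "nat \<Rightarrow> fold_letter" where "letters \<equiv> fold_limit S"
abbreviation head :: "nat \<Rightarrow> gauss" where "head \<equiv> heading letters"
abbreviation vert :: "nat \<Rightarrow> gauss" where "vert \<equiv> vertex letters"
abbreviation curve :: "nat \<Rightarrow> dart" where "curve \<equiv> curve_dart letters"

definition m :: nat where "m = Suc (length S)"
definition z :: gauss where "z = vert m"

lemma m_ge_2: "m \<ge> 2"
proof -
  have "length S \<ge> 1"
    using folding by (cases S) (auto simp: folding_string_def)
  then show ?thesis by (simp add: m_def)
qed

lemma letters_prefix: "n < length S \<Longrightarrow> letters n = S ! n"
  using fold_limit_prefix[OF folding, of n 1] by simp

lemma fold_power_long: "n < Suc (length (fold_power S n))"
proof -
  have "n < m ^ n"
    using m_ge_2 by (simp add: power_gt_expt)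
  then show ?thesis
    by (simp add: length_fold_power m_def)
qed

lemma letters_block:
  assumes "j < length S"
  shows "letters (m * k + j) = (if even k then S else fold_bar S) ! j"
proof -
  have k: "k \<le> length (fold_power S k)"
    using fold_power_long[of k] by simp
  have "m * k + j < m * Suc k"
    using assms by (simp add: m_def)
  also have "\<dots> \<le> m * Suc (length (fold_power S k))"
    using k by simp
  also have "\<dots> = Suc (length (fold_power S (Suc k)))"
    by (simp add: length_fold_power m_def del: fold_power.simps)
  finally have "m * k + j < Suc (length (fold_power S (Suc k)))" .
  moreover have "m * k + j \<noteq> length (fold_power S (Suc k))"
  proof
    assume *: "m * k + j = length (fold_power S (Suc k))"
    have "m dvd Suc (length (fold_power S (Suc k)))"
      by (simp only: length_fold_power m_def[symmetric] power_Suc dvd_triv_left)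
    then have "m dvd Suc (m * k + j)" by (simp only: *)
    then have "m dvd Suc j" using dvd_add_right_iff[of m "m * k" "Suc j"] by simp
    moreover have "Suc j < m" using assms by (simp add: m_def)
    ultimately show False using nat_dvd_not_less[of "Suc j" m] by simp
  qed
  ultimately have "letters (m * k + j) = fold_power S (Suc k) ! (m * k + j)"
    using fold_limit_prefix[OF folding, of "m * k + j" "Suc k"] by simp
  also have "\<dots> = (if even k then S else fold_bar S) ! j"
    unfolding fold_power_Suc_left m_def using nth_fold_conv_block[OF assms k] .
  finally show ?thesis .
qed

lemma letters_separator: "letters (m * k + length S) = letters k"
proof -
  have k: "k < length (fold_power S (Suc k))"
    using fold_power_long[of "Suc k"] by simp
  have "m * k + length S < length (fold_power S (Suc (Suc k)))"
  proof -
    have "Suc (m * k + length S) = m * Suc k"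
      by (simp add: m_def)
    also have "\<dots> < m * Suc (length (fold_power S (Suc k)))"
      using k m_ge_2 by simp
    also have "\<dots> = Suc (length (fold_power S (Suc (Suc k))))"
      by (simp add: length_fold_power m_def del: fold_power.simps)
    finally show ?thesis by simp
  qed
  then have "letters (m * k + length S) = fold_power S (Suc (Suc k)) ! (m * k + length S)"
    using fold_limit_prefix[OF folding] by (simp del: fold_power.simps)
  also have "\<dots> = fold_power S (Suc k) ! k"
    unfolding fold_power_Suc_left[of S "Suc k"] m_def using nth_fold_conv_separator[OF k] .
  also have "\<dots> = letters k"
    using fold_limit_prefix[OF folding k] .
  finally show ?thesis .
qed

text \<open>
  At the start of an odd block the curve has the direction \<open>head k * head (m - 1)\<close>, and the turns
  of \<open>fold_bar S\<close> undo those of \<open>S\<close> in reverse order, so the directions of the block are run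
  through backwards.
\<close>

lemma heading_block:
  assumes "j < m"
  shows "head (m * k + j) = head k * (if even k then head j else head (length S - j))"
  using assms
proof (induction k arbitrary: j)
  case 0
  then show ?case by simp
next
  case (Suc k)
  have start: "head (m * Suc k) = head (Suc k) * (if even k then head (length S) else 1)"
  proof -
    have "m * Suc k = Suc (m * k + length S)" by (simp add: m_def)
    then have "head (m * Suc k) = turn (letters k) * head (m * k + length S)"
      by (simp only: heading.simps letters_separator)
    then show ?thesis
      using Suc.IH[of "length S"] by (simp add: m_def mult.assoc)
  qed
  show ?case using \<open>j < m\<close>
  proof (induction j)
    case 0
    then show ?case using start by simp
  next
    case (Suc j)
    then have j: "j < length S" and IH: "head (m * Suc k + j) =
        head (Suc k) * (if even (Suc k) then head j else head (length S - j))"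
      by (simp_all add: m_def)
    have step: "head (m * Suc k + Suc j) = turn ((if even (Suc k) then S else fold_bar S) ! j) *
        head (m * Suc k + j)"
      using letters_block[OF j, of "Suc k"] by simp
    show ?case
    proof (cases "even (Suc k)")
      case True
      then show ?thesis
        using step IH letters_prefix[OF j] by (simp add: mult_ac del: mult_Suc_right)
    next
      case False
      let ?l = "length S - Suc j"
      have l: "length S - j = Suc ?l" using j by simp
      have "fold_bar S ! j = exchange (S ! ?l)"
        using j by (simp add: fold_bar_def rev_nth)
      moreover have "letters ?l = S ! ?l"
        using j by (intro letters_prefix) simp
      ultimately have "turn (fold_bar S ! j) * head (length S - j) = head ?l"
        using turn_exchange[of "S ! ?l"] unfolding l by (simp flip: mult.assoc)
      then show ?thesis
        using step IH False by (simp add: mult.left_commute del: mult_Suc_right heading.simps)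
    qed
  qed
qed

lemma vertex_block:
  assumes "j \<le> m"
  shows "vert (m * k + j) = z * vert k + head k * (if even k then vert j else z - vert (m - j))"
  using assms
proof (induction k arbitrary: j)
  case 0
  then show ?case by simp
next
  case (Suc k)
  have "m * Suc k = m * k + m" by simp
  then have start: "vert (m * Suc k) = z * vert (Suc k)"
    using Suc.IH[of m] by (simp only:) (simp add: z_def[symmetric] vertex_Suc distrib_left mult.commute)
  show ?case using \<open>j \<le> m\<close>
  proof (induction j)
    case 0
    then show ?case using start by (simp add: z_def[symmetric] del: mult_Suc_right)
  next
    case (Suc j)
    have "vert (m * Suc k + Suc j) = vert (m * Suc k + j) + head (m * Suc k + j)"
      by (simp only: add_Suc_right vertex_Suc)
    moreover have "vert (m - j) = vert (m - Suc j) + head (length S - j)"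
      using Suc.prems vertex_Suc[of letters "length S - j"] by (simp add: m_def Suc_diff_le)
    moreover have "head (m * Suc k + j) =
        head (Suc k) * (if even (Suc k) then head j else head (length S - j))"
      using Suc.prems by (intro heading_block) simp
    moreover have "vert (m * Suc k + j) =
        z * vert (Suc k) + head (Suc k) * (if even (Suc k) then vert j else z - vert (m - j))"
      using Suc by simp
    ultimately show ?case
      by (simp add: vertex_Suc[of _ j] distrib_left right_diff_distrib
          del: mult_Suc_right heading.simps)
  qed
qed

text \<open>
  The tile of the edge \<open>(p, u)\<close> is the curve of \<open>S\<close> turned by \<open>u\<close> and placed at \<open>zp\<close>;
  its edges are numbered from the end at the even point \<open>p\<close>.
\<close>

definition tile :: "nat \<Rightarrow> dart \<Rightarrow> dart" where
  "tile j e = shift (z * fst e) (turn_by (snd e) (curve j))"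

lemma tile_darts: "e \<in> darts \<Longrightarrow> tile j e \<in> darts"
  unfolding tile_def
  by (intro shift_darts turn_by_darts curve_dart_darts) (auto simp: darts_def even_pt_mult)

lemma tile_shift: "tile j (shift a e) = shift (z * a) (tile j e)"
  by (simp add: tile_def shift_def turn_by_def algebra_simps)

lemma tile_turn_by: "tile j (turn_by v e) = turn_by v (tile j e)"
  by (simp add: tile_def shift_def turn_by_def algebra_simps)

text \<open>
  The odd edges of the limit curve are run through towards their even endpoints, hence their tiles
  are run through backwards.
\<close>

definition tile_index :: "nat \<Rightarrow> nat \<Rightarrow> nat" where
  "tile_index k j = (if even k then j else length S - j)"

lemma tile_index_less: "j < m \<Longrightarrow> tile_index k j < m"
  by (auto simp: tile_index_def m_def)

lemma tile_index_idem: "j < m \<Longrightarrow> tile_index k (tile_index k j) = j"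
  by (auto simp: tile_index_def m_def)

text \<open>
  The limit curve is composed of the tiles of its own edges.
\<close>

lemma curve_block:
  assumes "j < m"
  shows "curve (m * k + j) = tile (tile_index k j) (curve k)"
proof -
  have h: "head (m * k + j) = head k * head (tile_index k j)"
    using heading_block[OF assms, of k] by (simp add: tile_index_def)
  have v: "vert (m * k + j) = z * vert k + head k * (if even k then vert j else z - vert (m - j))"
    using vertex_block[of j k] assms by simp
  have v': "vert (Suc (m * k + j)) =
      z * vert k + head k * (if even k then vert (Suc j) else z - vert (m - Suc j))"
    using vertex_block[of "Suc j" k] assms by simp
  show ?thesis
  proof (cases "even k")
    case True
    then show ?thesis
      using h v v' by (auto simp: curve_dart_def tile_def tile_index_def shift_def turn_by_def)
  next
    case False
    have i: "m - Suc j = tile_index k j" "m - j = Suc (tile_index k j)"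
      using False assms by (auto simp: tile_index_def m_def)
    have "even (m * k + j) \<longleftrightarrow> odd (tile_index k j)"
      using i(2) False assms by (metis even_Suc even_add even_diff_nat even_mult_iff less_imp_le linorder_not_less)
    then show ?thesis
      using h v v' False unfolding i
      by (auto simp: curve_dart_def tile_def shift_def turn_by_def vertex_Suc algebra_simps
          simp del: heading.simps)
  qed
qed

lemma tile_curve: "j < m \<Longrightarrow> tile j (curve k) = curve (m * k + tile_index k j)"
  using curve_block[OF tile_index_less] by (simp add: tile_index_idem)

lemma theta_La: "theta S [La] = map (step_seq letters) [0..<m]"
proof -
  have "take i S = map letters [0..<i]" if "i \<le> length S" for i
    using that by (intro nth_equalityI) (auto simp: letters_prefix)
  then show ?thesis
    by (auto simp: theta_def step_word_def step_seq_def m_def simp del: upt_Suc)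
qed

lemma displacement_theta_La: "displacement (theta S [La]) = cpx z"
  by (simp add: theta_La displacement_step_seq z_def)

lemma traverses_theta_La: "traverses (theta S [La]) s \<longleftrightarrow> (\<exists>j<m. segment (curve j) = s)"
proof -
  have "displacement (take j (theta S [La])) = cpx (vert j)" if "j \<le> m" for j
    using that by (simp add: theta_La take_map displacement_step_seq)
  moreover have "length (theta S [La]) = m"
    by (simp add: theta_La)
  ultimately show ?thesis
    by (auto simp: traverses_def segment_curve_dart simp del: take_Suc)
qed

end


section \<open>The tiles cover every edge exactly once\<close>

lemma even_pt_near: "\<exists>a. even_pt a \<and> norm (cpx a - x) \<le> 3"
proof -
  define a where "a = Gauss \<lfloor>Re x\<rfloor> \<lfloor>Im x\<rfloor>"
  have "norm (cpx a - x) \<le> \<bar>Re (cpx a - x)\<bar> + \<bar>Im (cpx a - x)\<bar>"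
    by (rule cmod_le)
  also have "\<dots> \<le> 1 + 1"
    unfolding a_def cpx_def by (intro add_mono) (simp; linarith)+
  finally have a: "norm (cpx a - x) \<le> 2" by simp
  show ?thesis
  proof (cases "even_pt a")
    case False
    then have "even_pt (a + 1)" using odd_dir[of 1] by simp
    moreover have "norm (cpx (a + 1) - x) \<le> norm (cpx a - x) + norm (1 :: complex)"
      using norm_triangle_ineq[of "cpx a - x" 1] by (simp add: algebra_simps)
    ultimately show ?thesis using a by (intro exI[of _ "a + 1"]) auto
  qed (use a in auto)
qed

definition incident :: "gauss \<Rightarrow> dart set" where
  "incident q = {e \<in> darts. q \<in> {fst e, fst e + snd e}}"

lemma finite_incident: "finite (incident q)"
  and card_incident: "card (incident q) \<le> 4"
proof -
  have dirs: "finite dirs" "card dirs \<le> 4"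
    using card_length[of "[1, gi, -1, -gi]"] by (simp_all add: dirs_def)
  let ?f = "\<lambda>u. if even_pt q then (q, u) else (q - u, u)"
  have "e \<in> ?f ` dirs" if "e \<in> incident q" for e
  proof -
    obtain p u where e: "e = (p, u)" by (cases e)
    have "u \<in> dirs" "even_pt p" "q = p \<or> q = p + u"
      using that by (auto simp: incident_def darts_def e)
    then show ?thesis
      using odd_dir[of u] by (auto simp: e intro!: image_eqI[of _ _ u])
  qed
  then have sub: "incident q \<subseteq> ?f ` dirs" by blast
  then show "finite (incident q)" using dirs(1) finite_surj by blast
  have "card (incident q) \<le> card dirs" using surj_card_le[OF dirs(1) sub] .
  then show "card (incident q) \<le> 4" using dirs(2) by simp
qed

locale planefilling_folding = folding +
  assumes avoiding: "self_avoiding S"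
    and planefilling: "planefilling S"
begin

lemma inj_curve: "inj curve"
proof -
  have "inj (\<lambda>n. segment (curve n))"
    using avoiding by (simp add: self_avoiding_def limit_edge_eq[abs_def])
  then show ?thesis by (auto simp: inj_def)
qed

text \<open>
  Each of two visits to \<open>q\<close> uses two edges at \<open>q\<close>, all four are different as the curve is
  self-avoiding, and there are only four edges at \<open>q\<close>. The starting point is excluded because
  its first visit uses a single edge.
\<close>

lemma incident_visited_twice:
  assumes "card {j. vert j = q} = 2" "q \<noteq> 0" "e \<in> incident q"
  shows "e \<in> range curve"
proof -
  obtain a b where ab: "{j. vert j = q} = {a, b}" "a \<noteq> b"
    using assms(1) by (auto simp: card_2_iff)
  then have v: "vert a = q" "vert b = q" by auto
  have pos: "a > 0" "b > 0"
    using v assms(2) by (auto intro!: Nat.gr0I)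
  have step: "vert (Suc n) \<noteq> vert n" for n
    using heading_dirs[of letters n] by (auto simp: vertex_Suc dirs_def gauss_eq_iff)
  have "a - 1 \<noteq> b" "b - 1 \<noteq> a"
    using step[of b] step[of a] v pos by (metis Suc_pred' One_nat_def)+
  then have "card {a - 1, a, b - 1, b} = 4"
    using ab(2) pos by (auto simp: card_insert_if gr0_conv_Suc)
  then have card: "card (curve ` {a - 1, a, b - 1, b}) = 4"
    using inj_curve by (metis card_image inj_on_subset subset_UNIV)
  have inc: "curve n \<in> incident q" "curve (n - 1) \<in> incident q" if "vert n = q" "n > 0" for n
  proof -
    show "curve n \<in> incident q"
      using curve_dart_ends[of letters n] that unfolding incident_def by fastforce
    show "curve (n - 1) \<in> incident q"
      using curve_dart_ends[of letters "n - 1"] that unfolding incident_def by fastforce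
  qed
  have "curve ` {a - 1, a, b - 1, b} \<subseteq> incident q"
    using inc v pos by auto
  then have "curve ` {a - 1, a, b - 1, b} = incident q"
    using card card_incident[of q] finite_incident[of q] by (metis card_seteq)
  then show ?thesis using assms(3) by blast
qed

text \<open>
  The radius leaves room for the odd endpoint of the edge, since one of the two endpoints may be
  the excluded starting point.
\<close>

lemma large_disc_covered:
  "\<exists>x. \<forall>e\<in>darts. norm (cpx (fst e) - x) \<le> r \<longrightarrow> e \<in> range curve"
proof -
  obtain R x where R: "R > r + 1" and
    x: "\<And>p. p \<in> grid_points \<inter> cball x R \<Longrightarrow> card {j. limit_vertex S j = p} = 2"
    using planefilling unfolding planefilling_def by metis
  have twice: "card {j. vert j = q} = 2" if "norm (cpx q - x) \<le> R" for q
  proof -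
    have "cpx q \<in> grid_points \<inter> cball x R"
      using that range_cpx by (auto simp: dist_norm norm_minus_commute)
    from x[OF this] show ?thesis
      by (simp add: limit_vertex_def displacement_step_seq)
  qed
  have "e \<in> range curve" if e: "e \<in> darts" "norm (cpx (fst e) - x) \<le> r" for e
  proof -
    have u: "snd e \<in> dirs" using e(1) by (auto simp: darts_def)
    have "norm (cpx (fst e + snd e) - x) \<le> norm (cpx (fst e) - x) + norm (cpx (snd e))"
      using norm_triangle_ineq[of "cpx (fst e) - x" "cpx (snd e)"] by (simp add: algebra_simps)
    then have "norm (cpx (fst e + snd e) - x) \<le> R" "norm (cpx (fst e) - x) \<le> R"
      using e(2) R norm_cpx_dir[OF u] by auto
    moreover have "fst e \<noteq> 0 \<or> fst e + snd e \<noteq> 0"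
      using u by (auto simp: dirs_def gauss_eq_iff)
    moreover have "e \<in> incident (fst e)" "e \<in> incident (fst e + snd e)"
      using e(1) by (auto simp: incident_def)
    ultimately show ?thesis
      using incident_visited_twice twice by metis
  qed
  then show ?thesis by blast
qed

text \<open>
  Translating by an even vector moves both edges into a region covered by the limit curve. Tiles of
  edges of the limit curve are disjoint sections of the limit curve, which does not repeat edges.
\<close>

lemma tile_inj:
  assumes "e \<in> darts" "f \<in> darts" "i < m" "j < m" "tile i e = tile j f"
  shows "e = f" and "i = j"
proof -
  define r where "r = 3 + norm (cpx (fst f) - cpx (fst e))"
  obtain x where x: "\<And>g. g \<in> darts \<Longrightarrow> norm (cpx (fst g) - x) \<le> r \<Longrightarrow> g \<in> range curve"
    using large_disc_covered[of r] by blast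
  obtain a where a: "even_pt a" "norm (cpx a - x) \<le> 3"
    using even_pt_near by blast
  define b where "b = a - fst e"
  have b: "even_pt b" using a(1) assms(1) by (auto simp: b_def darts_def)
  have "shift b e \<in> range curve"
    using a by (intro x shift_darts assms b) (simp add: shift_def b_def r_def add_increasing2)
  moreover have "shift b f \<in> range curve"
  proof (intro x shift_darts assms b)
    have "norm ((cpx a - x) + (cpx (fst f) - cpx (fst e))) \<le> r"
      unfolding r_def using a(2) by (intro norm_triangle_le) simp
    then show "norm (cpx (fst (shift b f)) - x) \<le> r"
      by (simp add: shift_def b_def algebra_simps)
  qed
  ultimately obtain k l where kl: "shift b e = curve k" "shift b f = curve l"
    by blast
  have "tile i (curve k) = tile j (curve l)"
    using assms(5) by (simp add: tile_shift flip: kl)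
  then have *: "m * k + tile_index k i = m * l + tile_index l j"
    using assms(3,4) inj_curve by (simp add: tile_curve inj_eq)
  have less: "tile_index k i < m" "tile_index l j < m"
    using assms(3,4) by (simp_all add: tile_index_less)
  have "(m * k + tile_index k i) div m = k" "(m * l + tile_index l j) div m = l"
    using less by simp_all
  then have "k = l" using * by simp
  then have "shift b e = shift b f" using kl by simp
  then show "e = f" by (simp add: shift_def prod_eq_iff)
  have "tile_index k i = tile_index k j" using * \<open>k = l\<close> by simp
  then show "i = j" using assms(3,4) tile_index_idem by metis
qed

lemma z_nonzero: "z \<noteq> 0"
proof
  assume "z = 0"
  then have "tile 0 (0, 1) = tile 0 (2, 1)"
    by (simp add: tile_def)
  moreover have "(0, 1) \<in> darts" "(2, 1) \<in> darts"
    by (auto simp: darts_def even_pt_def)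
  ultimately have "(0, 1) = (2 :: gauss, 1 :: gauss)"
    using tile_inj(1) m_ge_2 by (metis gr0I not_numeral_le_zero)
  then show False by (simp add: gauss_eq_iff)
qed

text \<open>
  A translate of the edge by \<open>za\<close> with \<open>a\<close> even lies on the limit curve, hence in the tile of
  an edge of the limit curve; translating back gives the edge wanted.
\<close>

lemma tile_surj:
  assumes "g \<in> darts"
  obtains e j where "e \<in> darts" "j < m" "tile j e = g"
proof -
  \<comment> \<open>The points \<open>za\<close> with \<open>a\<close> even come within \<open>3 * norm (cpx z)\<close> of any point.\<close>
  obtain x where x: "\<And>g. g \<in> darts \<Longrightarrow> norm (cpx (fst g) - x) \<le> 3 * norm (cpx z) \<Longrightarrow>
      g \<in> range curve"
    using large_disc_covered by blast
  obtain a where a: "even_pt a" "norm (cpx a - (x - cpx (fst g)) / cpx z) \<le> 3"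
    using even_pt_near by blast
  have "cpx z \<noteq> 0" using z_nonzero by (metis cpx_eq_iff cpx_simps(1))
  then have "cpx (fst (shift (z * a) g)) - x = cpx z * (cpx a - (x - cpx (fst g)) / cpx z)"
    by (simp add: shift_def field_simps)
  then have "norm (cpx (fst (shift (z * a) g)) - x) \<le> 3 * norm (cpx z)"
    using mult_left_mono[OF a(2) norm_ge_zero[of "cpx z"]] by (simp add: norm_mult mult.commute)
  then have "shift (z * a) g \<in> range curve"
    using a(1) assms by (intro x shift_darts) (auto simp: even_pt_mult)
  then obtain n where n: "shift (z * a) g = curve n" by blast
  have "n mod m < m" using m_ge_2 by simp
  moreover from this have "curve n = tile (tile_index (n div m) (n mod m)) (curve (n div m))"
    using curve_block[of "n mod m" "n div m"] by simp
  then have "tile (tile_index (n div m) (n mod m)) (shift (- a) (curve (n div m))) =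
      shift (- (z * a)) (shift (z * a) g)"
    using n by (simp add: tile_shift)
  then have "tile (tile_index (n div m) (n mod m)) (shift (- a) (curve (n div m))) = g"
    by (simp add: shift_def)
  ultimately show ?thesis
    using a(1) tile_index_less
    by (intro that[of "shift (- a) (curve (n div m))" "tile_index (n div m) (n mod m)"])
      (simp_all add: shift_darts)
qed

end


section \<open>Loops around faces and what they enclose\<close>

text \<open>
  The faces of colour \<open>c\<close> are exactly the faces \<open>2 * p + (1 + quarter c)\<close> with \<open>p\<close> even:
  the squares with lower left corner \<open>p\<close> for one colour and with upper left corner \<open>p\<close> for the
  other. \<open>border c p\<close> lists the sides of this square.
\<close>

definition quarter :: "bool \<Rightarrow> gauss" where
  "quarter c = (if c then gi else - gi)"

definition border :: "bool \<Rightarrow> gauss \<Rightarrow> dart list" where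
  "border c p = (let d = quarter c in [(p, 1), (p, d), (p + (1 + d), -1), (p + (1 + d), - d)])"

lemma set_border:
  assumes "even_pt p"
  shows "set (border c p) = {e \<in> darts. side c e = 2 * p + (1 + quarter c)}"
proof (intro equalityI subsetI)
  fix e assume "e \<in> set (border c p)"
  then show "e \<in> {e \<in> darts. side c e = 2 * p + (1 + quarter c)}"
    using assms
    by (auto simp: border_def quarter_def Let_def darts_def even_pt_def side_def gauss_eq_iff
        faces_sel split: if_splits)
next
  fix e assume e: "e \<in> {e \<in> darts. side c e = 2 * p + (1 + quarter c)}"
  obtain q u where [simp]: "e = (q, u)" by (cases e)
  have "u \<in> dirs" "even (re q + im q)" "side c (q, u) = 2 * p + (1 + quarter c)"
    using e by (auto simp: darts_def even_pt_def)
  then show "e \<in> set (border c p)"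
    using assms unfolding even_pt_def
    by (cases c; elim dirs_cases)
      (simp_all add: border_def quarter_def Let_def gauss_eq_iff faces_sel; presburger)+
qed

lemma border_darts: "even_pt p \<Longrightarrow> f \<in> set (border c p) \<Longrightarrow> f \<in> darts"
  by (simp add: set_border)

lemma distinct_border: "distinct (border c p)"
  by (auto simp: border_def quarter_def Let_def gauss_eq_iff)

lemma face_cell:
  assumes "e \<in> darts"
  obtains p where "even_pt p" "side c e = 2 * p + (1 + quarter c)"
proof -
  obtain q u where [simp]: "e = (q, u)" by (cases e)
  have u: "u \<in> dirs" "even_pt q" using assms by (auto simp: darts_def)
  have "side c e = 2 * q + (1 + quarter c) \<or>
      side c e = 2 * (q - (1 + quarter c)) + (1 + quarter c)"
    using u(1) by (cases c; elim dirs_cases) (auto simp: quarter_def gauss_eq_iff faces_sel)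
  moreover have "even_pt (q - (1 + quarter c))"
    using u(2) by (auto simp: even_pt_def quarter_def)
  ultimately show ?thesis using that u(2) by blast
qed

lemma border_shift: "border c (a + p) = map (shift a) (border c p)"
  by (simp add: border_def Let_def shift_def algebra_simps)

text \<open>
  \<open>ray F e\<close> means that the horizontal ray from the centre of \<open>F\<close> to the right crosses the
  (necessarily vertical) edge \<open>e\<close>.
\<close>

definition ray :: "gauss \<Rightarrow> dart \<Rightarrow> bool" where
  "ray F e \<longleftrightarrow> re (snd e) = 0 \<and> im (2 * fst e + snd e) = im F \<and> re (2 * fst e) > re F"

text \<open>
  The grid points to the right of a horizontal edge \<open>e\<close>, in the same row. A path enters or leaves
  this set by crossing the ray of one of the two faces of \<open>e\<close>, or along \<open>e\<close> itself. For
  vertical \<open>e\<close> the set is empty.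
\<close>

definition right_of :: "dart \<Rightarrow> gauss \<Rightarrow> bool" where
  "right_of e q \<longleftrightarrow>
     im (snd e) = 0 \<and> im q = im (fst e) \<and> re (2 * q) > re (2 * fst e + snd e)"

text \<open>
  The contribution of a single step \<open>g\<close> of a path to the jump of the crossing number across \<open>e\<close>:
  the last two summands cancel along a closed path, so that modulo 2 the crossing numbers of the two
  faces of \<open>e\<close> differ by the number of times the path uses \<open>e\<close>.
\<close>

lemma ray_parity:
  assumes "e \<in> darts" "g \<in> darts"
  shows "even (of_bool (ray (lface e) g) + of_bool (ray (rface e) g) + of_bool (g = e) +
    (of_bool (right_of e (fst g)) + of_bool (right_of e (fst g + snd g))) :: nat)"
proof -
  obtain p u q v where [simp]: "e = (p, u)" "g = (q, v)" by (cases e; cases g)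
  have "even (re p + im p)" "even (re q + im q)" "u \<in> dirs" "v \<in> dirs"
    using assms by (auto simp: darts_def even_pt_def)
  then show ?thesis
    by (elim dirs_cases)
      (simp_all add: ray_def right_of_def gauss_eq_iff faces_sel of_bool_def; presburger?)+
qed

lemma telescope_parity:
  fixes b :: "nat \<Rightarrow> nat"
  shows "even ((\<Sum>j<n. b j + b (Suc j)) + b 0 + b n)"
  by (induction n) auto

context folding
begin

text \<open>
  The tiles of the sides of a square form a closed path. A face counts as enclosed if its ray
  crosses the path an odd number of times, which replaces the interior in the sense of Jordan's
  theorem.
\<close>

definition crossings :: "bool \<Rightarrow> gauss \<Rightarrow> gauss \<Rightarrow> nat" where
  "crossings c p F = (\<Sum>f\<leftarrow>border c p. \<Sum>j<m. of_bool (ray F (tile j f)))"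

definition enclosed :: "bool \<Rightarrow> gauss \<Rightarrow> gauss set" where
  "enclosed c p = {F. odd (crossings c p F)}"

lemma tile_ends_parity:
  "even ((\<Sum>j<m. of_bool (B (fst (tile j f))) + of_bool (B (fst (tile j f) + snd (tile j f)))) +
     of_bool (B (z * fst f)) + of_bool (B (z * (fst f + snd f))) :: nat)"
proof -
  define b :: "nat \<Rightarrow> nat" where "b j = of_bool (B (z * fst f + snd f * vert j))" for j
  have "of_bool (B (fst (tile j f))) + of_bool (B (fst (tile j f) + snd (tile j f))) =
      b j + b (Suc j)" for j
  proof -
    have "tile j f = (if even j then (z * fst f + snd f * vert j, snd f * head j)
        else (z * fst f + snd f * vert (Suc j), - (snd f * head j)))"
      by (simp add: tile_def curve_dart_def shift_def turn_by_def del: heading.simps)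
    then show ?thesis
      by (simp add: b_def vertex_Suc algebra_simps del: heading.simps)
  qed
  moreover have "b 0 = of_bool (B (z * fst f))" "b m = of_bool (B (z * (fst f + snd f)))"
    by (simp_all add: b_def z_def algebra_simps)
  ultimately show ?thesis
    using telescope_parity[of b m] by (simp del: even_add)
qed

lemma tile_parity:
  assumes "e \<in> darts" "f \<in> darts"
  shows "even ((\<Sum>j<m. of_bool (ray (lface e) (tile j f))) +
    (\<Sum>j<m. of_bool (ray (rface e) (tile j f))) + (\<Sum>j<m. of_bool (tile j f = e)) +
    of_bool (right_of e (z * fst f)) + of_bool (right_of e (z * (fst f + snd f))) :: nat)"
proof -
  have "even (\<Sum>j<m. of_bool (ray (lface e) (tile j f)) + of_bool (ray (rface e) (tile j f)) +
      of_bool (tile j f = e) + (of_bool (right_of e (fst (tile j f))) +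
      of_bool (right_of e (fst (tile j f) + snd (tile j f)))) :: nat)"
    by (intro dvd_sum ray_parity tile_darts assms)
  then have "even ((\<Sum>j<m. of_bool (ray (lface e) (tile j f))) +
    (\<Sum>j<m. of_bool (ray (rface e) (tile j f))) + (\<Sum>j<m. of_bool (tile j f = e)) + (\<Sum>j<m. of_bool (right_of e (fst (tile j f))) +
      of_bool (right_of e (fst (tile j f) + snd (tile j f)))) :: nat)"
    by (simp only: sum.distrib)
  then show ?thesis
    using tile_ends_parity[of "right_of e" f] by (simp only: even_add)
qed

lemma crossings_shift: "crossings c (a + p) (2 * (z * a) + F) = crossings c p F"
proof -
  have "ray (2 * b + F) (shift b e) = ray F e" for b e
    by (auto simp: ray_def shift_def)
  then show ?thesis
    by (simp add: crossings_def border_shift tile_shift comp_def)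
qed

lemma enclosed_shift: "2 * (z * a) + F \<in> enclosed c (a + p) \<longleftrightarrow> F \<in> enclosed c p"
  by (simp add: enclosed_def crossings_shift)

lemma enclosed_bounded: "\<exists>b. \<forall>F\<in>enclosed c p. re F \<le> b"
proof -
  let ?T = "\<Union>f\<in>set (border c p). (\<lambda>j. tile j f) ` {..<m}"
  have fin: "finite ?T" by blast
  define b where "b = Max (insert 0 ((\<lambda>g. re (2 * fst g)) ` ?T))"
  have "re F \<le> b" if "F \<in> enclosed c p" for F
  proof -
    have "crossings c p F \<noteq> 0" using that unfolding enclosed_def by (metis even_zero mem_Collect_eq)
    then obtain f j where "f \<in> set (border c p)" "j < m" "ray F (tile j f)"
      by (auto simp: crossings_def sum_list_eq_0_iff)
    then have "re (2 * fst (tile j f)) > re F" "re (2 * fst (tile j f)) \<in> (\<lambda>g. re (2 * fst g)) ` ?T"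
      by (auto simp: ray_def)
    moreover from this have "re (2 * fst (tile j f)) \<le> b"
      unfolding b_def using fin by (intro Max_ge) auto
    ultimately show ?thesis by linarith
  qed
  then show ?thesis by blast
qed

text \<open>
  At an even point the tiles of perpendicular edges start with perpendicular edges; at an odd point
  they end with perpendicular edges. So the loop around a square turns at its four corners, too.
\<close>

lemma adj_tile_start:
  assumes "u \<in> dirs" "v = gi * u \<or> v = - gi * u"
  shows "adj (tile 0 (p, u)) (tile 0 (p, v))"
  using adj_corner(1)[OF assms, of "z * p"]
  by (simp add: tile_def curve_dart_def shift_def turn_by_def)

lemma adj_tile_end:
  assumes "u \<in> dirs" "v = gi * u \<or> v = - gi * u" "p + u = q + v"
  shows "adj (tile (m - 1) (p, u)) (tile (m - 1) (q, v))"
proof -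
  obtain a b where ab: "curve (m - 1) = (a, b)" by (cases "curve (m - 1)")
  have b: "b \<in> dirs"
    using curve_dart_darts[of letters "m - 1"] unfolding ab by (simp add: darts_def)
  have "Suc (m - 1) = m" using m_ge_2 by simp
  then have "z = a \<or> z = a + b"
    using curve_dart_ends[of letters "m - 1"] unfolding ab z_def by auto
  moreover have t: "tile (m - 1) (r, w) = (z * r + w * a, w * b)" for r w
    unfolding tile_def ab by (simp add: shift_def turn_by_def)
  have ub: "u * b \<in> dirs" "v * b = gi * (u * b) \<or> v * b = - gi * (u * b)"
    using assms b by (auto simp: dirs_mult)
  have eq: "z * q + v * z = z * p + u * z"
    using assms(3) by (metis distrib_left mult.commute)
  from calculation show ?thesis
  proof
    assume "z = a"
    then show ?thesis
      using adj_corner(1)[OF ub, of "z * p + u * z"] eq unfolding t by simp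
  next
    assume "z = a + b"
    then have a: "z * r + w * a = z * r + w * z - w * b" for r w
      by (simp add: algebra_simps)
    show ?thesis
      using adj_corner(2)[OF ub, of "z * p + u * z"] unfolding t a eq .
  qed
qed

end


context planefilling_folding
begin

definition parent :: "dart \<Rightarrow> dart" where
  "parent e = (THE f. f \<in> darts \<and> (\<exists>j<m. tile j f = e))"

lemma parent_tile:
  assumes "f \<in> darts" "j < m"
  shows "parent (tile j f) = f"
  unfolding parent_def using assms tile_inj(1) by (intro the_equality) blast+

lemma parentE:
  assumes "e \<in> darts"
  obtains j where "parent e \<in> darts" "j < m" "tile j (parent e) = e"
  using tile_surj[OF assms] parent_tile by metis

lemma parent_darts: "e \<in> darts \<Longrightarrow> parent e \<in> darts"
  by (erule parentE)

lemma parent_shift: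
  assumes "e \<in> darts" "even_pt a"
  shows "parent (shift (z * a) e) = shift a (parent e)"
proof -
  obtain j where "parent e \<in> darts" "j < m" "tile j (parent e) = e"
    using assms(1) by (rule parentE)
  then show ?thesis
    using parent_tile[of "shift a (parent e)" j] assms(2) by (simp add: tile_shift shift_darts)
qed

lemma parent_turn_by:
  assumes "e \<in> darts" "v \<in> dirs"
  shows "parent (turn_by v e) = turn_by v (parent e)"
proof -
  obtain j where "parent e \<in> darts" "j < m" "tile j (parent e) = e"
    using assms(1) by (rule parentE)
  then show ?thesis
    using parent_tile[of "turn_by v (parent e)" j] assms(2) by (simp add: tile_turn_by turn_by_darts)
qed

lemma parent_star:
  assumes "u \<in> dirs"
  shows "parent (0, u) = (0, u)"
proof -
  have "tile 0 (0, u) = (0, u)"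
    by (simp add: tile_def curve_dart_def shift_def turn_by_def)
  moreover have "(0, u) \<in> darts" using assms by (simp add: darts_def)
  ultimately show ?thesis using parent_tile[of "(0, u)" 0] m_ge_2 by simp
qed

text \<open>
  As \<open>S\<close> begins with \<open>D\<close>, its curve turns left after the first step, and its second edge
  leads from \<open>1\<close> to \<open>1 + i\<close>.
\<close>

lemma parent_second_edge: "parent (1 + gi, - gi) = (0, 1)"
proof -
  have "letters 0 = D"
    using letters_prefix[of 0] folding by (cases S) (auto simp: folding_string_def)
  then have "tile 1 (0, 1) = (1 + gi, - gi)"
    by (simp add: tile_def curve_dart_def shift_def turn_by_def vertex_Suc)
  moreover have "(0, 1) \<in> darts" by (simp add: darts_def)
  ultimately show ?thesis using parent_tile[of "(0, 1)" 1] m_ge_2 by simp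
qed

definition loop :: "bool \<Rightarrow> gauss \<Rightarrow> dart set" where
  "loop c p = {e \<in> darts. parent e \<in> set (border c p)}"

lemma loop_iff:
  "even_pt p \<Longrightarrow> e \<in> loop c p \<longleftrightarrow> e \<in> darts \<and> side c (parent e) = 2 * p + (1 + quarter c)"
  using parent_darts[of e] by (auto simp: loop_def set_border)

lemma loop_shift:
  assumes "even_pt a" "even_pt p" "e \<in> loop c p"
  shows "shift (z * a) e \<in> loop c (a + p)"
  using assms by (auto simp: loop_def parent_shift border_shift even_pt_mult intro: shift_darts)

lemma tile_in_loop:
  "even_pt p \<Longrightarrow> f \<in> set (border c p) \<Longrightarrow> j < m \<Longrightarrow> tile j f \<in> loop c p"
  using border_darts by (auto simp: loop_def parent_tile tile_darts)

lemma tile_count: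
  assumes e: "e \<in> darts" and f: "f \<in> darts"
  shows "(\<Sum>j<m. of_bool (tile j f = e)) = (of_bool (parent e = f) :: nat)"
proof (cases "parent e = f")
  case True
  obtain k where k: "k < m" "tile k f = e"
    using parentE[OF e] True by metis
  have "(\<Sum>j<m. of_bool (tile j f = e)) = (\<Sum>j\<in>{k}. of_bool (tile j f = e) :: nat)"
    using k tile_inj(2)[OF f f] by (intro sum.mono_neutral_right) auto
  then show ?thesis using k True by simp
next
  case False
  have "tile j f \<noteq> e" if "j < m" for j
    using parent_tile[OF f that] False by auto
  then show ?thesis using False by simp
qed

text \<open>
  Since tiles do not overlap, the loop uses each of its edges once, and the crossing numbers of two
  neighbouring faces have different parity exactly at the edges of the loop.
\<close>

lemma loop_separates:
  assumes "even_pt p" "e \<in> darts"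
  shows "(lface e \<in> enclosed c p) \<noteq> (rface e \<in> enclosed c p) \<longleftrightarrow> e \<in> loop c p"
proof -
  have count: "(\<Sum>j<m. of_bool (tile j f = e)) = (of_bool (parent e = f) :: nat)"
    if "f \<in> darts" for f
    using tile_count[OF assms(2) that] .
  let ?N = "\<lambda>F f. (\<Sum>j<m. of_bool (ray F (tile j f))) :: nat"
  have par: "even (?N (lface e) f + ?N (rface e) f + of_bool (parent e = f) +
      of_bool (right_of e (z * fst f)) + of_bool (right_of e (z * (fst f + snd f))))"
    if "f \<in> set (border c p)" for f
    using tile_parity[OF assms(2) border_darts[OF assms(1) that]]
    unfolding count[OF border_darts[OF assms(1) that]] .
  obtain f1 f2 f3 f4 where f: "border c p = [f1, f2, f3, f4]"
    and corners: "fst f1 = fst f2" "fst f3 = fst f4" "fst f1 + snd f1 = fst f4 + snd f4"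
      "fst f2 + snd f2 = fst f3 + snd f3"
    by (rule that[of "(p, 1)" "(p, quarter c)" "(p + (1 + quarter c), -1)"
          "(p + (1 + quarter c), - quarter c)"]) (simp_all add: border_def Let_def)
  define t where "t = crossings c p (lface e) + crossings c p (rface e) +
      of_bool (parent e \<in> set (border c p))"
  define M where "M f = ?N (lface e) f + ?N (rface e) f + of_bool (parent e = f)" for f
  define R where "R q = (of_bool (right_of e (z * q)) :: nat)" for q
  have "of_bool (parent e \<in> set (border c p)) = (of_bool (parent e = f1) +
      of_bool (parent e = f2) + of_bool (parent e = f3) + of_bool (parent e = f4) :: nat)"
    using distinct_border[of c p] by (auto simp: f)
  then have t: "t = M f1 + M f2 + M f3 + M f4"
    by (simp add: t_def M_def crossings_def f)
  have ev: "even (M f + R (fst f) + R (fst f + snd f))" if "f \<in> set (border c p)" for f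
    using par[OF that] by (simp only: M_def R_def)
  have "f1 \<in> set (border c p)" "f2 \<in> set (border c p)" "f3 \<in> set (border c p)"
    "f4 \<in> set (border c p)"
    by (simp_all add: f)
  from this[THEN ev] have "even ((M f1 + R (fst f1) + R (fst f1 + snd f1)) + (M f2 + R (fst f2) + R (fst f2 + snd f2)) +
      (M f3 + R (fst f3) + R (fst f3 + snd f3)) + (M f4 + R (fst f4) + R (fst f4 + snd f4)))"
    by (simp only: dvd_add)
  \<comment> \<open>Each corner of the square is an endpoint of two of its sides.\<close>
  also have "\<dots> = t + 2 * (R (fst f2) + R (fst f4) + R (fst f4 + snd f4) + R (fst f3 + snd f3))"
    unfolding t arg_cong[OF corners(1), of R] arg_cong[OF corners(2), of R]
      arg_cong[OF corners(3), of R] arg_cong[OF corners(4), of R] by (simp add: add_ac)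
  finally have "even t" by simp
  then show ?thesis
    using assms(2) by (auto simp: t_def enclosed_def loop_def)
qed

text \<open>
  The loop is a closed path whose successive edges form corners: along each tile because the
  curve turns everywhere, and at the four corners of the square by \<open>adj_tile_start\<close> and
  \<open>adj_tile_end\<close>. Therefore a property that passes from each edge to adjacent ones is constant
  on the loop.
\<close>

lemma loop_connected:
  assumes p: "even_pt p"
    and step: "\<And>e f. e \<in> loop c p \<Longrightarrow> f \<in> loop c p \<Longrightarrow> adj e f \<Longrightarrow> P e = P f"
    and e: "e \<in> loop c p" and f: "f \<in> loop c p"
  shows "P e = P f"
proof -
  have along: "P (tile j f) = P (tile 0 f)" if "j < m" "f \<in> set (border c p)" for j f
    using that(1)
  proof (induction j)
    case (Suc j)
    have "snd f \<in> dirs" using border_darts[OF p that(2)] by (auto simp: darts_def)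
    then have "adj (tile j f) (tile (Suc j) f)"
      unfolding tile_def by (intro adj_shift adj_turn_by adj_curve_dart)
    then have "P (tile j f) = P (tile (Suc j) f)"
      using Suc.prems by (intro step tile_in_loop p that) auto
    then show ?case using Suc by simp
  qed simp
  let ?d = "quarter c"
  define f1 where "f1 = (p, 1 :: gauss)"
  define f2 where "f2 = (p, ?d)"
  define f3 where "f3 = (p + (1 + ?d), - 1 :: gauss)"
  define f4 where "f4 = (p + (1 + ?d), - ?d)"
  have border: "set (border c p) = {f1, f2, f3, f4}"
    by (simp add: border_def Let_def f1_def f2_def f3_def f4_def)
  have m: "0 < m" "m - 1 < m" using m_ge_2 by auto
  have d: "?d \<in> dirs" "?d = gi \<or> ?d = - gi" by (auto simp: quarter_def)
  have "adj (tile 0 f1) (tile 0 f2)"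
    unfolding f1_def f2_def using d by (intro adj_tile_start) auto
  then have "P (tile 0 f1) = P (tile 0 f2)"
    using border m by (intro step tile_in_loop p) auto
  moreover have "adj (tile (m - 1) f1) (tile (m - 1) f4)"
    unfolding f1_def f4_def using d by (intro adj_tile_end) auto
  then have "P (tile (m - 1) f1) = P (tile (m - 1) f4)"
    using border m by (intro step tile_in_loop p) auto
  moreover have "adj (tile (m - 1) f3) (tile (m - 1) f2)"
    unfolding f3_def f2_def using d by (intro adj_tile_end) auto
  then have "P (tile (m - 1) f3) = P (tile (m - 1) f2)"
    using border m by (intro step tile_in_loop p) auto
  ultimately have all: "P (tile j f) = P (tile 0 f1)" if "j < m" "f \<in> set (border c p)" for j f
    using that along[of "m - 1"] along[of j] m unfolding border by auto
  have "P g = P (tile 0 f1)" if "g \<in> loop c p" for g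
  proof -
    have g: "g \<in> darts" "parent g \<in> set (border c p)" using that by (auto simp: loop_def)
    then show ?thesis using all parentE by metis
  qed
  then show ?thesis using e f by simp
qed

text \<open>
  Adjacent edges of the loop have a face in common, and of the two faces of an edge of the loop
  exactly one is enclosed. So the inner side has the same colour along the entire loop.
\<close>

lemma loop_side_constant:
  assumes "even_pt p" "e \<in> loop c p" "f \<in> loop c p"
  shows "side c' e \<in> enclosed c p \<longleftrightarrow> side c' f \<in> enclosed c p"
proof -
  have "lface e \<in> enclosed c p \<longleftrightarrow> lface f \<in> enclosed c p"
  proof (rule loop_connected[OF assms(1) _ assms(2,3)])
    fix e f assume "e \<in> loop c p" "f \<in> loop c p" "adj e f"
    moreover from this have "e \<in> darts" "f \<in> darts" by (auto simp: loop_def)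
    ultimately show "lface e \<in> enclosed c p \<longleftrightarrow> lface f \<in> enclosed c p"
      using loop_separates[OF assms(1)] unfolding adj_def by metis
  qed
  moreover have "e \<in> darts" "f \<in> darts" using assms by (auto simp: loop_def)
  ultimately show ?thesis
    using loop_separates[OF assms(1), of e c] loop_separates[OF assms(1), of f c] assms(2,3)
    by (cases c') auto
qed

lemma odd_face:
  assumes "e \<in> darts"
  shows "odd (re (side c e))" "odd (im (side c e))"
proof -
  have "snd e \<in> dirs" using assms by (auto simp: darts_def)
  then show "odd (re (side c e))" "odd (im (side c e))"
    by (cases c; elim dirs_cases; simp add: faces_sel)+
qed

lemma edge_between_faces:
  assumes "odd (re F)" "odd (im F)" "v \<in> dirs"
  obtains c e where "e \<in> darts" "side c e = F" "side (\<not> c) e = F + 2 * v"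
proof -
  obtain a b where ab: "re F = 2 * a + 1" "im F = 2 * b + 1"
    using assms(1,2) by (auto elim!: oddE)
  define c where "c = even (a + b)"
  define p where "p = Gauss a (if c then b else b + 1)"
  have F: "F = 2 * p + (1 + quarter c)"
    by (simp add: gauss_eq_iff p_def quarter_def ab)
  have p: "even_pt p"
    by (simp add: p_def even_pt_def c_def)
  have *: "\<exists>e\<in>set (border c p). side (\<not> c) e = F + 2 * v"
    using assms(3) unfolding F
    by (cases c; elim dirs_cases)
      (auto simp: border_def quarter_def Let_def gauss_eq_iff faces_sel)
  then show ?thesis using that p F set_border[OF p, of c] by auto
qed

text \<open>
  Otherwise, as the loops have no edge in common, all faces along either loop would be enclosed by
  the other one. A rightmost face that is enclosed by one of the loops has on its right an edge of
  that loop, hence is followed by a face which the other loop encloses, a contradiction.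
\<close>

lemma no_common_enclosed_face:
  assumes "even_pt p" "even_pt q" "p \<noteq> q"
    and e: "e \<in> loop c p" "side c' e \<in> enclosed c p"
    and f: "f \<in> loop c q" "side c' f \<in> enclosed c q"
  shows "side c' e \<noteq> side c' f"
proof
  assume eq: "side c' e = side c' f"
  have disjoint: "g \<notin> loop c q" if "g \<in> loop c p" for g
    using that assms(1-3) by (auto simp: loop_iff gauss_eq_iff)
  have in_q: "lface g \<in> enclosed c q" "rface g \<in> enclosed c q" if g: "g \<in> loop c p" for g
  proof -
    have same: "lface g \<in> enclosed c q \<longleftrightarrow> rface g \<in> enclosed c q" if "g \<in> loop c p" for g
      using that disjoint loop_separates[OF assms(2), of g c] by (auto simp: loop_def)
    have "lface g \<in> enclosed c q \<longleftrightarrow> lface e \<in> enclosed c q"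
      by (rule loop_connected[OF assms(1) _ g e(1)]) (metis adj_def same)
    moreover have "lface e \<in> enclosed c q"
      using same[OF e(1)] f(2) eq by (cases c') auto
    ultimately show "lface g \<in> enclosed c q" "rface g \<in> enclosed c q"
      using same[OF g] by auto
  qed
  have in_p: "lface g \<in> enclosed c p" "rface g \<in> enclosed c p" if g: "g \<in> loop c q" for g
  proof -
    have same: "lface g \<in> enclosed c p \<longleftrightarrow> rface g \<in> enclosed c p" if "g \<in> loop c q" for g
      using that disjoint[of g] loop_separates[OF assms(1), of g c] by (auto simp: loop_def)
    have "lface g \<in> enclosed c p \<longleftrightarrow> lface f \<in> enclosed c p"
      by (rule loop_connected[OF assms(2) _ g f(1)]) (metis adj_def same)
    moreover have "lface f \<in> enclosed c p"
      using same[OF f(1)] e(2) eq by (cases c') auto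
    ultimately show "lface g \<in> enclosed c p" "rface g \<in> enclosed c p"
      using same[OF g] by auto
  qed
  \<comment> \<open>Only points with odd coordinates are faces, although \<open>enclosed\<close> is defined at all points.\<close>
  let ?X = "\<lambda>F. odd (re F) \<and> odd (im F) \<and> F \<in> enclosed c p \<union> enclosed c q"
  obtain b1 b2 where "\<forall>F\<in>enclosed c p. re F \<le> b1" "\<forall>F\<in>enclosed c q. re F \<le> b2"
    using enclosed_bounded by metis
  then have b: "re F \<le> max b1 b2" if "?X F" for F
    using that by auto
  have "?X (side c' e)" using e odd_face by (auto simp: loop_def)
  then obtain F where F: "?X F" and
    rightmost: "\<And>G. ?X G \<Longrightarrow> nat (max b1 b2 - re F) \<le> nat (max b1 b2 - re G)"
    using ex_has_least_nat[of ?X _ "\<lambda>F. nat (max b1 b2 - re F)"] by blast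
  have "\<not> ?X (F + 2 * 1)"
    using rightmost[of "F + 2 * 1"] b[of "F + 2 * 1"] by auto
  then have out: "F + 2 * 1 \<notin> enclosed c p" "F + 2 * 1 \<notin> enclosed c q"
    using F by auto
  obtain k g where g: "g \<in> darts" "side k g = F" "side (\<not> k) g = F + 2 * 1"
    using F edge_between_faces[of F 1] dirs_simps(1) by metis
  then have faces: "{lface g, rface g} = {F, F + 2 * 1}" by (cases k) auto
  from F consider "F \<in> enclosed c p" | "F \<in> enclosed c q" by blast
  then show False
  proof cases
    case 1
    then have "g \<in> loop c p"
      using loop_separates[OF assms(1) g(1), of c] faces out by (metis doubleton_eq_iff)
    then show False using in_q[of g] faces out by (metis doubleton_eq_iff)
  next
    case 2
    then have "g \<in> loop c q"
      using loop_separates[OF assms(2) g(1), of c] faces out by (metis doubleton_eq_iff)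
    then show False using in_p[of g] faces out by (metis doubleton_eq_iff)
  qed
qed

text \<open>
  By translation, the inner side has the same colour for all squares of one colour. If it were the
  opposite colour, consider the two squares of colour \<open>c\<close> at \<open>0\<close>. Their loops contain the
  edges of the star in the directions \<open>1\<close> and \<open>- quarter c\<close>, which are their own parents, and
  both loops would enclose the square between these two edges.
\<close>

lemma loop_encloses_own_side:
  assumes "even_pt p" "e \<in> loop c p"
  shows "side c e \<in> enclosed c p"
proof (rule ccontr)
  assume "side c e \<notin> enclosed c p"
  then have other: "side (\<not> c) e \<in> enclosed c p"
    using loop_separates[OF assms(1), of e c] assms(2) by (cases c) (auto simp: loop_def)
  have all: "side (\<not> c) f \<in> enclosed c q" if q: "even_pt q" and f: "f \<in> loop c q" for q f
  proof -
    let ?a = "p - q"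
    have a: "even_pt ?a" using q assms(1) by simp
    have "shift (z * ?a) f \<in> loop c p"
      using loop_shift[OF a q f] by simp
    then have "side (\<not> c) (shift (z * ?a) f) \<in> enclosed c p"
      using loop_side_constant[OF assms(1) assms(2)] other by blast
    moreover have "side (\<not> c) (shift (z * ?a) f) = 2 * (z * ?a) + side (\<not> c) f"
      by (simp add: side_def face_shift)
    ultimately show ?thesis using enclosed_shift[of "?a" "side (\<not> c) f" c q] by simp
  qed
  let ?q = "- (1 + quarter c)"
  have q: "even_pt ?q" by (auto simp: even_pt_def quarter_def)
  have e0: "(0, 1) \<in> loop c 0"
    by (cases c) (auto simp: loop_iff parent_star darts_def gauss_eq_iff quarter_def faces_sel)
  have f0: "(0, - quarter c) \<in> loop c ?q"
    using q by (cases c) (auto simp: loop_iff parent_star darts_def gauss_eq_iff quarter_def faces_sel)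
  have "0 \<noteq> ?q" by (simp add: gauss_eq_iff quarter_def)
  then have "side (\<not> c) (0, 1) \<noteq> side (\<not> c) (0, - quarter c)"
    by (intro no_common_enclosed_face[OF _ q _ e0 _ f0] all e0 f0 q) simp_all
  moreover have "side (\<not> c) (0, 1) = side (\<not> c) (0, - quarter c)"
    by (cases c) (auto simp: gauss_eq_iff quarter_def faces_sel)
  ultimately show False by contradiction
qed

text \<open>
  The common face of \<open>e\<close> and \<open>f\<close> is enclosed by the loop through \<open>e\<close> and by the loop through
  \<open>f\<close>, so these loops are the same.
\<close>

lemma parent_respects_faces:
  assumes "e \<in> darts" "f \<in> darts" "side c e = side c f"
  shows "side c (parent e) = side c (parent f)"
proof -
  obtain p where p: "even_pt p" "side c (parent e) = 2 * p + (1 + quarter c)"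
    using face_cell parent_darts assms(1) by metis
  obtain q where q: "even_pt q" "side c (parent f) = 2 * q + (1 + quarter c)"
    using face_cell parent_darts assms(2) by metis
  have "e \<in> loop c p" "f \<in> loop c q"
    using p q assms by (simp_all add: loop_iff)
  then have "p = q"
    using no_common_enclosed_face[OF p(1) q(1)] loop_encloses_own_side p(1) q(1) assms(3) by blast
  then show ?thesis using p q by simp
qed

end


section \<open>Iterating the parent map\<close>

text \<open>
  Faces are given by doubled coordinates, so this is twice the number of steps from face to
  neighbouring face.
\<close>

definition face_dist :: "gauss \<Rightarrow> gauss \<Rightarrow> int" where
  "face_dist F G = \<bar>re F - re G\<bar> + \<bar>im F - im G\<bar>"

lemma face_dist_triangle: "face_dist F H \<le> face_dist F G + face_dist G H"
  by (simp add: face_dist_def)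

lemma face_dist_sides: "e \<in> darts \<Longrightarrow> face_dist (side c e) (side (\<not> c) e) = 2"
  by (cases c; auto simp: darts_def dirs_def face_dist_def faces_sel)

lemma step_towards:
  assumes "odd (re F)" "odd (im F)" "odd (re H)" "odd (im H)" "F \<noteq> H"
  obtains v where "v \<in> dirs" "face_dist (F + 2 * v) H = face_dist F H - 2"
proof -
  consider "re F < re H" | "re F > re H" | "im F < im H" | "im F > im H"
    using assms(5) unfolding gauss_eq_iff by linarith
  then show ?thesis
  proof cases
    case 1
    then have "re F + 2 \<le> re H" using assms by presburger
    then show ?thesis by (intro that[of 1]) (auto simp: face_dist_def)
  next
    case 2
    then have "re H + 2 \<le> re F" using assms by presburger
    then show ?thesis by (intro that[of "-1"]) (auto simp: face_dist_def)
  next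
    case 3
    then have "im F + 2 \<le> im H" using assms by presburger
    then show ?thesis by (intro that[of gi]) (auto simp: face_dist_def)
  next
    case 4
    then have "im H + 2 \<le> im F" using assms by presburger
    then show ?thesis by (intro that[of "-gi"]) (auto simp: face_dist_def)
  qed
qed

context planefilling_folding
begin

abbreviation ancestor :: "nat \<Rightarrow> dart \<Rightarrow> dart" where
  "ancestor n \<equiv> parent ^^ n"

lemma ancestor_darts: "e \<in> darts \<Longrightarrow> ancestor n e \<in> darts"
  by (induction n) (auto intro: parent_darts)

lemma ancestor_turn_by:
  "e \<in> darts \<Longrightarrow> v \<in> dirs \<Longrightarrow> ancestor n (turn_by v e) = turn_by v (ancestor n e)"
  by (induction n) (auto simp: parent_turn_by ancestor_darts)

lemma ancestor_star: "u \<in> dirs \<Longrightarrow> ancestor n (0, u) = (0, u)"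
  by (induction n) (auto simp: parent_star)

lemma ancestor_respects_faces:
  assumes "e \<in> darts" "f \<in> darts" "side c e = side c f"
  shows "side c (ancestor n e) = side c (ancestor n f)"
  using assms by (induction n) (auto intro: parent_respects_faces ancestor_darts)

text \<open>
  A step between neighbouring faces crosses an edge, and the images of the two faces are the two
  sides of an ancestor of this edge. A shortest path of faces is thus mapped to a path.
\<close>

lemma ancestor_contracts:
  assumes "e \<in> darts" "f \<in> darts"
  shows "face_dist (side c (ancestor n e)) (side c' (ancestor n f)) \<le>
    face_dist (side c e) (side c' f)"
  using assms
proof (induction "nat (face_dist (side c e) (side c' f))" arbitrary: c e rule: less_induct)
  case less
  let ?F = "side c e" and ?H = "side c' f"
  show ?case
  proof (cases "?F = ?H")
    case True
    then have "c = c'" using side_colour less.prems by blast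
    then show ?thesis
      using True ancestor_respects_faces[OF less.prems] by (simp add: face_dist_def)
  next
    case False
    obtain v where v: "v \<in> dirs" "face_dist (?F + 2 * v) ?H = face_dist ?F ?H - 2"
      using step_towards False odd_face less.prems by metis
    obtain k g where g: "g \<in> darts" "side k g = ?F" "side (\<not> k) g = ?F + 2 * v"
      using edge_between_faces odd_face less.prems(1) v(1) by metis
    have "k = c" using side_colour g(1,2) less.prems(1) by blast
    have pos: "face_dist (?F + 2 * v) ?H \<ge> 0" by (simp add: face_dist_def)
    have "face_dist (side (\<not> c) (ancestor n g)) (side c' (ancestor n f)) \<le>
        face_dist (side (\<not> c) g) ?H"
      using pos v g \<open>k = c\<close> less.prems by (intro less.hyps) auto
    moreover have "side c (ancestor n e) = side c (ancestor n g)"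
      using g \<open>k = c\<close> less.prems by (intro ancestor_respects_faces) auto
    moreover have "face_dist (side c (ancestor n g)) (side (\<not> c) (ancestor n g)) = 2"
      using g by (intro face_dist_sides ancestor_darts)
    ultimately show ?thesis
      using face_dist_triangle[of "side c (ancestor n g)" "side c' (ancestor n f)"
          "side (\<not> c) (ancestor n g)"] g \<open>k = c\<close> v by simp
  qed
qed

text \<open>
  By \<open>ancestor_respects_faces\<close> the \<open>n\<close>-th ancestor acts on faces; these are its fixed points.
\<close>

definition fixed_face :: "nat \<Rightarrow> gauss \<Rightarrow> bool" where
  "fixed_face n F \<longleftrightarrow> (\<exists>c e. e \<in> darts \<and> side c e = F \<and> side c (ancestor n e) = F)"

lemma fixed_face_turn:
  assumes "fixed_face n F"
  shows "fixed_face n (gi * F)"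
proof -
  obtain c e where e: "e \<in> darts" "side c e = F" "side c (ancestor n e) = F"
    using assms by (auto simp: fixed_face_def)
  have "side (\<not> c) (turn_by gi f) = gi * side c f" for f
    by (simp add: side_def face_turn_by_gi)
  then show ?thesis
    unfolding fixed_face_def using e
    by (intro exI[of _ "\<not> c"] exI[of _ "turn_by gi e"]) (auto simp: ancestor_turn_by turn_by_darts)
qed

lemma fixed_face_odd: "fixed_face n F \<Longrightarrow> odd (re F) \<and> odd (im F)"
  using odd_face by (auto simp: fixed_face_def)

lemma fixed_face_bound:
  assumes "fixed_face n F" "g \<in> darts"
  shows "face_dist (side c (ancestor n g)) F \<le> face_dist (side c g) F"
  using assms ancestor_contracts[OF assms(2)] unfolding fixed_face_def by metis

text \<open>
  The edge \<open>g\<close> from \<open>1 + i\<close> to \<open>1\<close> and the edge \<open>h\<close> from \<open>1 + i\<close> to \<open>i\<close> complete the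
  square at \<open>0\<close>. That square is its own image, so the parent of \<open>h\<close> is another of its sides;
  then two steps suffice to bring both edges into the star. The outer face of \<open>g\<close> or \<open>h\<close>
  thereby moves away from all faces of the quadrant that lie beyond it.
\<close>

lemma fixed_face_quadrant:
  assumes F: "fixed_face n F" and n: "n \<ge> 2"
    and no_loop: "parent (1 + gi, -1) \<noteq> (1 + gi, -1)"
    and quadrant: "re F > 0" "im F > 0"
  shows "re F \<le> 1" and "im F \<le> 1"
proof -
  let ?g = "(1 + gi, - gi)" and ?h = "(1 + gi, -1 :: gauss)"
  have darts: "?g \<in> darts" "?h \<in> darts" "(0, 1) \<in> darts" "(0, gi) \<in> darts"
    by (auto simp: darts_def even_pt_def)
  define k where "k = n - 2"
  then have k: "n = Suc (Suc k)"
    using n by simp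
  have "ancestor n ?g = (0, 1)"
    unfolding k funpow_Suc_right by (simp add: parent_second_edge parent_star ancestor_star)
  then have 1: "face_dist (rface (0, 1)) F \<le> face_dist (rface ?g) F"
    using fixed_face_bound[OF F darts(1), of False] by simp
  show "re F \<le> 1"
  proof (rule ccontr)
    assume "\<not> re F \<le> 1"
    then have "re F \<ge> 3" using fixed_face_odd[OF F] by presburger
    then show False using 1 quadrant by (simp add: face_dist_def faces_sel)
  qed
  have "lface ?h = lface (0, 1)"
    by (simp add: gauss_eq_iff faces_sel)
  then have "lface (parent ?h) = lface (0, 1)"
    using parent_respects_faces[OF darts(2,3), of True] by (simp add: parent_star)
  then have "parent ?h \<in> set (border True 0)"
    using parent_darts[OF darts(2)] by (simp add: set_border gauss_eq_iff faces_sel quarter_def)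
  then have "parent ?h \<in> {(0, 1), (0, gi), ?g}"
    using no_loop by (auto simp: border_def quarter_def Let_def)
  then have "parent (parent ?h) \<in> {(0, 1), (0, gi)}"
    by (auto simp: parent_star parent_second_edge)
  then have "ancestor n ?h \<in> {(0, 1), (0, gi)}"
    unfolding k funpow_Suc_right by (auto simp: ancestor_star)
  then have "face_dist (rface (0, 1)) F \<le> face_dist (rface ?h) F \<or>
      face_dist (rface (0, gi)) F \<le> face_dist (rface ?h) F"
    using fixed_face_bound[OF F darts(2), of False] by auto
  then have 2: "\<bar>1 - re F\<bar> + \<bar>- 1 - im F\<bar> \<le> \<bar>1 - re F\<bar> + \<bar>3 - im F\<bar> \<or>
      \<bar>- 1 - re F\<bar> + \<bar>1 - im F\<bar> \<le> \<bar>1 - re F\<bar> + \<bar>3 - im F\<bar>"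
    by (simp add: face_dist_def faces_sel)
  show "im F \<le> 1"
  proof (rule ccontr)
    assume "\<not> im F \<le> 1"
    then have "im F \<ge> 3" using fixed_face_odd[OF F] by presburger
    then show False using 2 quadrant by linarith
  qed
qed

text \<open>
  The fixed faces are permuted by the rotations about \<open>0\<close>, which reduces the claim to the first
  quadrant.
\<close>

lemma fixed_face_central:
  assumes F: "fixed_face n F" and n: "n \<ge> 2"
    and no_loop: "parent (1 + gi, -1) \<noteq> (1 + gi, -1)"
  shows "\<bar>re F\<bar> \<le> 1" and "\<bar>im F\<bar> \<le> 1"
proof -
  have nz: "re F \<noteq> 0" "im F \<noteq> 0"
    using fixed_face_odd[OF F] by auto
  have F1: "fixed_face n (gi * F)" using F by (rule fixed_face_turn)
  have F2: "fixed_face n (- F)" using fixed_face_turn[OF F1] by simp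
  have F3: "fixed_face n (- (gi * F))" using fixed_face_turn[OF F2] by simp
  note Q = fixed_face_quadrant[OF _ n no_loop]
  consider "re F > 0" "im F > 0" | "re F < 0" "im F > 0" | "re F < 0" "im F < 0" | "re F > 0" "im F < 0"
    using nz by linarith
  then have "\<bar>re F\<bar> \<le> 1 \<and> \<bar>im F\<bar> \<le> 1"
  proof cases
    case 1
    then show ?thesis using Q[OF F] by simp
  next
    case 2
    then show ?thesis using Q[OF F3] by simp
  next
    case 3
    then show ?thesis using Q[OF F2] by simp
  next
    case 4
    then show ?thesis using Q[OF F1] by simp
  qed
  then show "\<bar>re F\<bar> \<le> 1" "\<bar>im F\<bar> \<le> 1" by auto
qed

lemma periodic_at_origin:
  assumes e: "e \<in> darts" "ancestor n e = e" and n: "n \<ge> 2"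
    and no_loop: "parent (1 + gi, -1) \<noteq> (1 + gi, -1)"
  shows "fst e = 0"
proof -
  have "fixed_face n (side c e)" for c
    unfolding fixed_face_def using e by (intro exI[of _ c] exI[of _ e]) simp
  then have "\<bar>re (side c e)\<bar> \<le> 1 \<and> \<bar>im (side c e)\<bar> \<le> 1" for c
    using fixed_face_central n no_loop by blast
  note central = this[of True] this[of False]
  obtain p u where pu: "e = (p, u)" by (cases e)
  have u: "u \<in> dirs" and even: "even (re p + im p)"
    using e(1) by (auto simp: pu darts_def even_pt_def)
  have "re p = 0 \<and> im p = 0"
    using u
  proof (cases rule: dirs_cases)
    case 1
    then have "\<bar>2 * re p + 1\<bar> \<le> 1" "\<bar>2 * im p + 1\<bar> \<le> 1" "\<bar>2 * im p - 1\<bar> \<le> 1"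
      using central by (simp_all add: pu faces_sel)
    then have "im p = 0" "re p = 0 \<or> re p = -1" by linarith+
    then show ?thesis using even by auto
  next
    case 2
    then have "\<bar>2 * re p + 1\<bar> \<le> 1" "\<bar>2 * im p + 1\<bar> \<le> 1" "\<bar>2 * re p - 1\<bar> \<le> 1"
      using central by (simp_all add: pu faces_sel)
    then have "re p = 0" "im p = 0 \<or> im p = -1" by linarith+
    then show ?thesis using even by auto
  next
    case 3
    then have "\<bar>2 * re p - 1\<bar> \<le> 1" "\<bar>2 * im p + 1\<bar> \<le> 1" "\<bar>2 * im p - 1\<bar> \<le> 1"
      using central by (simp_all add: pu faces_sel)
    then have "im p = 0" "re p = 0 \<or> re p = 1" by linarith+
    then show ?thesis using even by auto
  next
    case 4
    then have "\<bar>2 * im p - 1\<bar> \<le> 1" "\<bar>2 * re p + 1\<bar> \<le> 1" "\<bar>2 * re p - 1\<bar> \<le> 1"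
      using central by (simp_all add: pu faces_sel)
    then have "re p = 0" "im p = 0 \<or> im p = 1" by linarith+
    then show ?thesis using even by auto
  qed
  then show ?thesis by (simp add: pu gauss_eq_iff)
qed

lemma finite_near_darts: "finite {e \<in> darts. face_dist (lface e) F \<le> b}"
proof -
  define l where "l = \<bar>re F\<bar> + \<bar>im F\<bar> + \<bar>b\<bar> + 1"
  have sub: "{e \<in> darts. face_dist (lface e) F \<le> b} \<subseteq>
      (\<lambda>((x, y), u). (Gauss x y, u)) ` (({- l..l} \<times> {- l..l}) \<times> dirs)"
  proof
    fix e assume "e \<in> {e \<in> darts. face_dist (lface e) F \<le> b}"
    moreover obtain p u where pu: "e = (p, u)" by (cases e)
    ultimately have *: "u \<in> dirs" "face_dist (lface (p, u)) F \<le> b"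
      by (auto simp: darts_def)
    have "\<bar>re u + im u\<bar> = 1" using *(1) by (auto simp: dirs_def)
    then have "re p \<in> {- l..l}" "im p \<in> {- l..l}"
      using *(2) by (auto simp: face_dist_def faces_sel l_def)
    then show "e \<in> (\<lambda>((x, y), u). (Gauss x y, u)) ` (({- l..l} \<times> {- l..l}) \<times> dirs)"
      using *(1) by (auto simp: pu image_iff gauss_eq_iff intro!: bexI[of _ "((re p, im p), u)"])
  qed
  show ?thesis
    by (rule finite_subset[OF sub]) (simp add: dirs_def)
qed

text \<open>
  The distance to a face at \<open>0\<close> does not increase along the orbit, so the orbit is finite and
  enters a cycle. The length of the cycle is doubled to have at least two steps.
\<close>

lemma reaches_origin:
  assumes e: "e \<in> darts" and no_loop: "parent (1 + gi, -1) \<noteq> (1 + gi, -1)"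
  obtains n u where "u \<in> dirs" "ancestor n e = (0, u)"
proof -
  let ?o = "\<lambda>k. ancestor k e"
  have "(0, 1) \<in> darts" by (simp add: darts_def)
  from ancestor_contracts[OF e this, of True _ True]
  have "face_dist (lface (?o k)) (lface (0, 1)) \<le> face_dist (lface e) (lface (0, 1))" for k
    by (simp add: ancestor_star)
  then have "range ?o \<subseteq> {f \<in> darts. face_dist (lface f) (lface (0, 1)) \<le> face_dist (lface e) (lface (0, 1))}"
    using ancestor_darts[OF e] by auto
  then have "finite (range ?o)"
    using finite_near_darts by (rule finite_subset)
  then have "\<not> inj ?o"
    using finite_imageD infinite_UNIV_nat by blast
  then obtain k l where "k < l" "?o k = ?o l"
    unfolding inj_def by (metis linorder_neq_iff)
  then obtain d where d: "l = d + k" "d > 0"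
    by (metis add.commute less_imp_add_positive)
  let ?f = "?o k"
  have f: "?f \<in> darts" using ancestor_darts[OF e] .
  have 1: "ancestor d ?f = ?f"
    using \<open>?o k = ?o l\<close> by (simp add: d funpow_add)
  then have "ancestor (d + d) ?f = ?f"
    by (simp add: funpow_add)
  then have "fst ?f = 0"
    using periodic_at_origin[OF f _ _ no_loop, of "d + d"] d by simp
  moreover have "snd ?f \<in> dirs" using f by (auto simp: darts_def)
  ultimately show ?thesis
    using that[of "snd ?f" k] by (metis prod.collapse)
qed

section \<open>Perfection\<close>

text \<open>
  The edge with index \<open>j\<close> of the limit curve lies in the tile of its edge with index
  \<open>j div m\<close>; the rotated curves are the descendants of the edges of the star.
\<close>

lemma parent_turned_curve:
  assumes "v \<in> dirs"
  shows "parent (turn_by v (curve j)) = turn_by v (curve (j div m))"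
proof -
  have j: "j mod m < m" using m_ge_2 by simp
  have "curve j = tile (tile_index (j div m) (j mod m)) (curve (j div m))"
    using curve_block[OF j, of "j div m"] by simp
  then have "parent (curve j) = curve (j div m)"
    using parent_tile[OF curve_dart_darts tile_index_less[OF j]] by simp
  then show ?thesis using assms by (simp add: parent_turn_by)
qed

lemma ancestor_turned_curve:
  assumes "v \<in> dirs" "j \<le> n"
  shows "ancestor n (turn_by v (curve j)) = (0, v)"
  using assms(2)
proof (induction n arbitrary: j)
  case 0
  then show ?case by (simp add: curve_dart_def turn_by_def)
next
  case (Suc n)
  have "j div m \<le> j div 2" using m_ge_2 by (simp add: div_le_mono2)
  then have "j div m \<le> n" using Suc.prems by linarith
  then show ?case
    using Suc.IH assms(1) by (simp add: funpow_Suc_right parent_turned_curve del: funpow.simps)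
qed

lemma turned_curve_inj:
  assumes "v \<in> dirs" "w \<in> dirs" "turn_by v (curve i) = turn_by w (curve j)"
  shows "v = w" and "i = j"
proof -
  have "ancestor (max i j) (turn_by v (curve i)) = ancestor (max i j) (turn_by w (curve j))"
    using assms(3) by simp
  then show "v = w" using assms(1,2) by (simp add: ancestor_turned_curve)
  have "cpx v \<noteq> 0" using norm_cpx_dir[OF assms(1)] by auto
  then have "v * a = v * b \<longleftrightarrow> a = b" for a b
    by (metis cpx_eq_iff cpx_simps(7) mult_left_cancel)
  then have "curve i = curve j"
    using assms(3) \<open>v = w\<close> by (simp add: turn_by_def prod_eq_iff)
  then show "i = j" using inj_curve by (simp add: inj_eq)
qed

lemma turned_curve_if_reaches_origin:
  assumes "e \<in> darts" "u \<in> dirs" "ancestor n e = (0, u)"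
  shows "\<exists>v j. v \<in> dirs \<and> e = turn_by v (curve j)"
  using assms(1,3)
proof (induction n arbitrary: e)
  case 0
  then have "e = turn_by u (curve 0)" by (simp add: curve_dart_def turn_by_def)
  then show ?case using assms(2) by blast
next
  case (Suc n)
  then have "ancestor n (parent e) = (0, u)"
    by (simp add: funpow_Suc_right del: funpow.simps)
  then obtain v j where v: "v \<in> dirs" "parent e = turn_by v (curve j)"
    using Suc parent_darts by blast
  obtain i where "i < m" "tile i (parent e) = e"
    using Suc.prems(1) by (rule parentE)
  then have "e = turn_by v (curve (m * j + tile_index j i))"
    using v by (simp add: tile_turn_by tile_curve)
  then show ?case using v by blast
qed

lemma rotated_limit_edge:
  "(\<lambda>p. \<i> ^ k * p) ` limit_edge S j = segment (turn_by (gi ^ k) (curve j))"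
  by (simp add: limit_edge_eq segment_turn_by)

lemma perfect_iff_unique_dart:
  "perfect S \<longleftrightarrow> (\<forall>e\<in>darts. \<exists>!(k, j). k < (4::nat) \<and> turn_by (gi ^ k) (curve j) = e)"
proof -
  have "segment (turn_by (gi ^ k) (curve j)) = segment e \<longleftrightarrow> turn_by (gi ^ k) (curve j) = e"
    if "e \<in> darts" for k j e
    using segment_inj[OF turn_by_darts[OF gi_power_in_dirs curve_dart_darts] that] by blast
  then show ?thesis
    using avoiding by (simp add: perfect_def rotated_limit_edge flip: segment_image)
qed

text \<open>
  If \<open>h\<close> is its own parent and is the edge with index \<open>j\<close> of one of the curves, then \<open>h\<close> also
  has an index between \<open>m * j\<close> and \<open>m * j + m - 1\<close> on the same curve. So \<open>j = 0\<close>, but \<open>h\<close>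
  does not belong to the star.
\<close>

lemma perfect_iff_parent: "perfect S \<longleftrightarrow> parent (1 + gi, -1) \<noteq> (1 + gi, -1)"
proof
  let ?h = "(1 + gi, -1 :: gauss)"
  have h: "?h \<in> darts" by (simp add: darts_def even_pt_def)
  assume "perfect S"
  then have "\<exists>!(k, j). k < (4::nat) \<and> turn_by (gi ^ k) (curve j) = ?h"
    using h unfolding perfect_iff_unique_dart by blast
  then obtain x where x: "case x of (k, j) \<Rightarrow> k < (4::nat) \<and> turn_by (gi ^ k) (curve j) = ?h"
    and unique_x: "\<And>y. case y of (k, j) \<Rightarrow> k < (4::nat) \<and> turn_by (gi ^ k) (curve j) = ?h \<Longrightarrow> y = x"
    by (elim ex1E) blast
  obtain k j where kj: "x = (k, j)" "k < 4" "turn_by (gi ^ k) (curve j) = ?h"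
    using x by (cases x) auto
  have unique: "l = k \<and> i = j" if "l < 4" "turn_by (gi ^ l) (curve i) = ?h" for l i
    using unique_x[of "(l, i)"] that kj(1) by simp
  show "parent ?h \<noteq> ?h"
  proof
    assume "parent ?h = ?h"
    then obtain i where i: "i < m" "tile i ?h = ?h"
      using parentE[OF h] by metis
    then have "turn_by (gi ^ k) (curve (m * j + tile_index j i)) = ?h"
      by (simp add: tile_curve[symmetric] tile_turn_by[symmetric] kj)
    then have "m * j + tile_index j i = j" using unique kj(2) by blast
    moreover have "2 * j \<le> m * j" using m_ge_2 by simp
    ultimately have "j = 0" by linarith
    then show False using kj(3) by (simp add: curve_dart_def turn_by_def gauss_eq_iff)
  qed
next
  assume no_loop: "parent (1 + gi, -1) \<noteq> (1 + gi, -1)"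
  show "perfect S"
    unfolding perfect_iff_unique_dart
  proof
    fix e assume e: "e \<in> darts"
    obtain n u where "u \<in> dirs" "ancestor n e = (0, u)"
      using reaches_origin[OF e no_loop] .
    then obtain v j where v: "v \<in> dirs" "e = turn_by v (curve j)"
      using turned_curve_if_reaches_origin[OF e] by blast
    obtain k where k: "k < 4" "v = gi ^ k"
      using dirs_eq_gi_power[OF v(1)] by blast
    show "\<exists>!(k, j). k < (4::nat) \<and> turn_by (gi ^ k) (curve j) = e"
    proof (rule ex1I[of _ "(k, j)"])
      show "case (k, j) of (k, j) \<Rightarrow> k < 4 \<and> turn_by (gi ^ k) (curve j) = e"
        using k v by simp
    next
      fix x assume "case x of (k, j) \<Rightarrow> k < 4 \<and> turn_by (gi ^ k) (curve j) = e"
      then obtain l i where x: "x = (l, i)" "l < 4" "turn_by (gi ^ l) (curve i) = turn_by (gi ^ k) (curve j)"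
        using k v by auto
      from turned_curve_inj[OF gi_power_in_dirs gi_power_in_dirs x(3)]
      show "x = (k, j)" using x(1,2) k(1) gi_power_inj by blast
    qed
  qed
qed

text \<open>
  The tile of \<open>h\<close> is the image of the curve of \<open>S\<close> under the point reflection
  \<open>x \<mapsto> (1 + i)z - x\<close>, which maps \<open>h\<close> to the segment of the theorem.
\<close>

lemma parent_iff_traverses:
  "parent (1 + gi, -1) = (1 + gi, -1) \<longleftrightarrow>
     traverses (theta S [La]) (closed_segment ((1 + \<i>) * cpx z - \<i> - 1) ((1 + \<i>) * cpx z - \<i>))"
proof -
  let ?h = "(1 + gi, -1 :: gauss)" and ?k = "((1 + gi) * z - gi - 1, 1 :: gauss)"
  have h: "?h \<in> darts" by (simp add: darts_def even_pt_def)
  have "even_pt ((1 + gi) * z)"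
    by (rule even_pt_mult(2)) (simp add: even_pt_def)
  then have k: "?k \<in> darts" by (simp add: darts_def odd_dir del: even_pt_simps(3))
  have "tile j ?h = ?h \<longleftrightarrow> curve j = ?k" for j
    by (auto simp: tile_def shift_def turn_by_def prod_eq_iff gauss_eq_iff algebra_simps)
  then have "parent ?h = ?h \<longleftrightarrow> (\<exists>j<m. curve j = ?k)"
    using parentE[OF h] parent_tile[OF h] by metis
  also have "\<dots> \<longleftrightarrow> (\<exists>j<m. segment (curve j) = segment ?k)"
    by (metis segment_inj curve_dart_darts k)
  also have "\<dots> \<longleftrightarrow> traverses (theta S [La]) (segment ?k)"
    by (simp add: traverses_theta_La)
  finally show ?thesis
    by (simp add: segment_def)
qed

end

theorem theorem5:
  fixes S :: "fold_letter list" and z :: complex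
  assumes "folding_string S"
    and "self_avoiding S"
    and "planefilling S"
    and "z = displacement (theta S [La])"
  shows "perfect S \<longleftrightarrow>
    \<not> traverses (theta S [La]) (closed_segment ((1 + \<i>) * z - \<i> - 1) ((1 + \<i>) * z - \<i>))"
proof -
  interpret planefilling_folding S
    by unfold_locales (use assms in auto)
  show ?thesis
    using perfect_iff_parent parent_iff_traverses assms(4) by (simp add: displacement_theta_La)
qed

end
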